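(* Let $\pi$ be a positive integer. Then there exists a one-dimensional commutative Noetherian local ring $(R,\mathfrak{m})$ of prime characteristic such that the function $\phi_{\mathfrak{m},R}$ is immediately periodic with period $\pi$.
   Context: Let $(R,\mathfrak{m})$ be a one-dimensional commutative Noetherian local ring of prime characteristic $p$. For a nonnegative integer $e$, let $\mathfrak{m}^{[p^e]}$ denote the ideal $(r^{p^e} : r\in\mathfrak{m})$ of $R$. The Hilbert--Kunz function $HK_{\mathfrak{m},R}$ sends every nonnegative integer $e$ to the length of $R/\mathfrak{m}^{[p^e]}$ over $R$. By a theorem of Monsky, there exist a positive integer $\operatorname{e}_{HK}(\mathfrak{m},R)$ (the Hilbert--Kunz multiplicity of $R$) and an eventually periodic integer-valued function $\phi_{\mathfrak{m},R}$ on the nonnegative integers such that $HK_{\mathfrak{m},R}(e)=\operatorname{e}_{HK}(\mathfrak{m},R)\cdot p^e-\phi_{\mathfrak{m},R}(e)$ for every nonnegative integer $e$; these are uniquely determined, and this defines $\phi_{\mathfrak{m},R}$. A function $\phi$ on the nonnegative integers is immediately periodic with period $\pi$ if $\pi$ is the least positive integer such that $\phi(e+\pi)=\phi(e)$ for all integers $e\geqslant 0$. *)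

theory Defs
  imports
    "HOL-Algebra.QuotRing"
    "HOL-Algebra.Ring_Divisibility"
    "HOL-Library.Extended_Nat"
    "HOL-Computational_Algebra.Primes"
begin

text \<open>
  Supremum of the lengths \<open>n\<close> of strict chains
  \<open>C 0 \<subset> C 1 \<subset> \<dots> \<subset> C n\<close> of sets with property \<open>P\<close>.
\<close>

definition sup_chain_length :: "('a set \<Rightarrow> bool) \<Rightarrow> enat" where
  "sup_chain_length P =
     Sup {enat n | n. \<exists>C :: nat \<Rightarrow> 'a set. (\<forall>i\<le>n. P (C i)) \<and> (\<forall>i<n. C i \<subset> C (Suc i))}"

definition krull_dim :: "('a, 'c) ring_scheme \<Rightarrow> enat" where
  "krull_dim R = sup_chain_length (\<lambda>P. primeideal P R)"

definition local_ring :: "('a, 'c) ring_scheme \<Rightarrow> 'a set \<Rightarrow> bool" where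
  "local_ring R m \<longleftrightarrow> cring R \<and> maximalideal m R \<and> (\<forall>n. maximalideal n R \<longrightarrow> n = m)"

text \<open>As for \<open>CHAR('a)\<close>, the value is \<open>0\<close> if no positive multiple of \<open>\<one>\<close> vanishes.\<close>

definition ring_char :: "('a, 'c) ring_scheme \<Rightarrow> nat" where
  "ring_char R = Gcd {n :: nat. [n] \<cdot>\<^bsub>R\<^esub> \<one>\<^bsub>R\<^esub> = \<zero>\<^bsub>R\<^esub>}"

definition module_length :: "('a, 'c) ring_scheme \<Rightarrow> ('a, 'b, 'd) module_scheme \<Rightarrow> enat" where
  "module_length R M = sup_chain_length (\<lambda>N. submodule N R M)"

text \<open>
  \<open>R/I\<close> as an \<open>R\<close>-module, with \<open>r \<odot> (I + x) = I + r \<otimes> x\<close>.  The fields \<open>mult\<close> and \<open>one\<close>,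
  present because modules extend the ring record, are those of the quotient ring.
\<close>

definition quot_module :: "('a, 'c) ring_scheme \<Rightarrow> 'a set \<Rightarrow> ('a, 'a set) module" where
  "quot_module R I =
     \<lparr>carrier = carrier (R Quot I), mult = mult (R Quot I), one = one (R Quot I),
      zero = zero (R Quot I), add = add (R Quot I),
      smult = (\<lambda>r Y. (I +>\<^bsub>R\<^esub> r) \<otimes>\<^bsub>R Quot I\<^esub> Y)\<rparr>"

lemma module_quot_module:
  assumes "cring R" "ideal I R"
  shows "module R (quot_module R I)"
proof -
  interpret R: cring R by fact
  interpret I: ideal I R by fact
  interpret Q: ring "R Quot I" by (rule I.quotient_is_ring)
  interpret h: ring_hom_ring R "R Quot I" "(+>\<^bsub>R\<^esub>) I" by (rule I.rcos_ring_hom_ring)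
  show ?thesis
  proof (rule moduleI)
    show "abelian_group (quot_module R I)"
      by (rule abelian_groupI)
        (auto simp: quot_module_def Q.add.m_ac intro: Q.add.l_inv_ex)
  qed (use assms in \<open>auto simp: quot_module_def Q.l_distr Q.r_distr Q.m_assoc\<close>)
qed

definition frobenius_power :: "('a, 'c) ring_scheme \<Rightarrow> 'a set \<Rightarrow> nat \<Rightarrow> 'a set" where
  "frobenius_power R I q = genideal R {r [^]\<^bsub>R\<^esub> q | r. r \<in> I}"

definition hilbert_kunz :: "('a, 'c) ring_scheme \<Rightarrow> 'a set \<Rightarrow> nat \<Rightarrow> enat" where
  "hilbert_kunz R m e =
     module_length R (quot_module R (frobenius_power R m (ring_char R ^ e)))"

definition eventually_periodic :: "(nat \<Rightarrow> 'a) \<Rightarrow> bool" where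
  "eventually_periodic f \<longleftrightarrow> (\<exists>t>0. \<exists>N. \<forall>e\<ge>N. f (e + t) = f e)"

definition immediately_periodic :: "(nat \<Rightarrow> 'a) \<Rightarrow> nat \<Rightarrow> bool" where
  "immediately_periodic f t \<longleftrightarrow>
     t > 0 \<and> (\<forall>e. f (e + t) = f e) \<and> (\<forall>s. 0 < s \<and> (\<forall>e. f (e + s) = f e) \<longrightarrow> t \<le> s)"

text \<open>
  \<open>hk_decomposition R m \<mu> \<phi>\<close> says that all lengths \<open>HK(e)\<close> are finite and
  \<open>HK(e) = \<mu> p\<^sup>e - \<phi>(e)\<close> with \<open>\<mu> > 0\<close> and \<open>\<phi>\<close> eventually periodic.  For a one-dimensional
  Noetherian local ring of prime characteristic \<open>p\<close> such a pair exists by Monsky's theorem and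
  is unique, so that \<open>hk_phi\<close> is well defined there; elsewhere its value is meaningless.
\<close>

definition hk_decomposition ::
    "('a, 'c) ring_scheme \<Rightarrow> 'a set \<Rightarrow> nat \<Rightarrow> (nat \<Rightarrow> int) \<Rightarrow> bool" where
  "hk_decomposition R m \<mu> \<phi> \<longleftrightarrow>
     \<mu> > 0 \<and> eventually_periodic \<phi> \<and>
     (\<forall>e. \<exists>l. hilbert_kunz R m e = enat l \<and> int l = int \<mu> * int (ring_char R) ^ e - \<phi> e)"

definition hk_phi :: "('a, 'c) ring_scheme \<Rightarrow> 'a set \<Rightarrow> nat \<Rightarrow> int" where
  "hk_phi R m = (THE \<phi>. \<exists>\<mu>. hk_decomposition R m \<mu> \<phi>)"

end

(*
Put n = 2^pi + 1, K = F_2((u)) and k = F_2((u^n)), so that K has the k-basis 1, u, ..., u^(n-1).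
The ring is the one-dimensional domain R = k[[x, y]] / (y^n - u^n x^n), embedded in K[[t]] by
x = t and y = u t.  With q = 2^e = n a + r and 0 <= r < n, the quotient R / (x^q, y^q) has a k-basis
of monomials x^i y^b with b < n, i < q and b + n (i div n) < q, so its length is
n^2 a + r^2 = n q - r (n - r).  Hence phi(e) = r (n - r) with r = 2^e mod n.  This has period pi
because 2^pi = -1 modulo n and r (n - r) is invariant under r -> n - r; no smaller period is
possible because 2^s (n - 2^s) is different from n - 1 for 0 < s < pi.

In K[[t]] every ideal containing f of order d contains all power series of order at least d + n.
Hence ideals are determined by finitely many leading positions (a degree in t together with an
exponent of u modulo n), which yields the Noetherian property, the maximal ideal, the
prime spectrum and the upper bounds for lengths.
*)
theory Submission
  imports
    Defs
    "HOL-Library.Z2"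
    "HOL-Library.Nat_Bijection"
    "HOL-Computational_Algebra.Formal_Laurent_Series"
begin

unbundle Formal_Power_Series.fps_syntax
unbundle Formal_Laurent_Series.fps_syntax

section \<open>Chains of submodules of a cyclic module\<close>

lemma sup_chain_length_eqI:
  assumes "\<forall>i\<le>N. P (C i)" "\<forall>i<N. C i \<subset> C (Suc i)"
    and ub: "\<And>n C. \<forall>i\<le>n. P (C i) \<Longrightarrow> \<forall>i<n. C i \<subset> C (Suc i) \<Longrightarrow> n \<le> N"
  shows "sup_chain_length P = enat N"
  unfolding sup_chain_length_def
proof (rule antisym)
  show "Sup {enat n |n. \<exists>C. (\<forall>i\<le>n. P (C i)) \<and> (\<forall>i<n. C i \<subset> C (Suc i))} \<le> enat N"
    by (rule Sup_least) (use ub in fastforce)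
  show "enat N \<le> Sup {enat n |n. \<exists>C. (\<forall>i\<le>n. P (C i)) \<and> (\<forall>i<n. C i \<subset> C (Suc i))}"
    by (rule Sup_upper) (use assms in blast)
qed

text \<open>A strictly monotone map carries strict chains to strict chains of the same length. Two
  such maps in opposite directions give equality, and they need not be shown to be mutually
  inverse.\<close>

lemma sup_chain_length_mono_map:
  assumes "\<And>X. P X \<Longrightarrow> Q (F X)"
    and "\<And>X Y. P X \<Longrightarrow> P Y \<Longrightarrow> X \<subset> Y \<Longrightarrow> F X \<subset> F Y"
  shows "sup_chain_length P \<le> sup_chain_length Q"
  unfolding sup_chain_length_def
proof (rule Sup_subset_mono, clarify)
  fix n C assume C: "\<forall>i\<le>n. P (C i)" "\<forall>i<n. C i \<subset> C (Suc i)"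
  have "\<forall>i\<le>n. Q (F (C i))" "\<forall>i<n. F (C i) \<subset> F (C (Suc i))"
    using C assms by auto
  then show "\<exists>na. enat n = enat na \<and> (\<exists>C. (\<forall>i\<le>na. Q (C i)) \<and> (\<forall>i<na. C i \<subset> C (Suc i)))"
    by (intro exI[of _ n] conjI refl exI[of _ "\<lambda>i. F (C i)"])
qed

text \<open>This is the correspondence theorem: \<open>F\<close> (preimage under the projection) and
  \<open>G\<close> (image) are strictly monotone between submodules of R/I and ideals above I.
  Lengths thereby become chains of ideals of the ring itself.\<close>

lemma module_length_quot_module:
  fixes R (structure)
  assumes "cring R" "ideal I R"
  shows "module_length R (quot_module R I) = sup_chain_length (\<lambda>J. ideal J R \<and> I \<subseteq> J)"
proof -
  interpret R: cring R by fact
  interpret I: ideal I R by fact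
  interpret M: module R "quot_module R I" by (rule module_quot_module) fact+
  have carr: "carrier (quot_module R I) = (\<lambda>x. I +> x) ` carrier R"
    by (auto simp: quot_module_def FactRing_def A_RCOSETS_def' a_r_coset_def r_coset_def)
  have zer: "\<zero>\<^bsub>quot_module R I\<^esub> = I"
    by (simp add: quot_module_def FactRing_def)
  have add: "(I +> x) \<oplus>\<^bsub>quot_module R I\<^esub> (I +> y) = I +> (x \<oplus> y)"
    if "x \<in> carrier R" "y \<in> carrier R" for x y
    using that by (simp add: quot_module_def FactRing_def I.a_rcos_sum)
  have smult: "r \<odot>\<^bsub>quot_module R I\<^esub> (I +> x) = I +> (r \<otimes> x)"
    if "x \<in> carrier R" "r \<in> carrier R" for x r
    using that by (simp add: quot_module_def FactRing_def I.rcoset_mult_add)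
  have eq_iff: "I +> x = I +> y \<longleftrightarrow> x \<ominus> y \<in> I" if "x \<in> carrier R" "y \<in> carrier R" for x y
    using R.quotient_eq_iff_same_a_r_cos[OF assms(2) that] by simp
  define F where "F = (\<lambda>N. {x \<in> carrier R. I +> x \<in> N})"
  define G where "G = (\<lambda>J. (\<lambda>x. I +> x) ` J)"
  have F: "ideal (F N) R \<and> I \<subseteq> F N" if "submodule N R (quot_module R I)" for N
  proof -
    interpret N: submodule N R "quot_module R I" by fact
    \<comment> \<open>A submodule is a subgroup of the additive monoid, whose unit is zero.\<close>
    have z: "\<zero>\<^bsub>quot_module R I\<^esub> \<in> N" using N.one_closed by simp
    have I: "I \<subseteq> F N"
      using z I.a_rcos_const I.a_subset by (auto simp: F_def zer)
    have sm: "r \<otimes> x \<in> F N" if "r \<in> carrier R" "x \<in> F N" for r x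
      using that N.smult_closed[of r "I +> x"] smult by (auto simp: F_def)
    have pl: "x \<oplus> y \<in> F N" if "x \<in> F N" "y \<in> F N" for x y
      using that N.m_closed[of "I +> x" "I +> y"] add by (auto simp: F_def)
    have sub: "F N \<subseteq> carrier R" by (auto simp: F_def)
    have mi: "\<ominus> x \<in> F N" if "x \<in> F N" for x
      using sm[of "\<ominus> \<one>" x] that sub by (auto simp: R.l_minus)
    have "ideal (F N) R"
    proof (rule idealI)
      show "subgroup (F N) (add_monoid R)"
      proof (rule R.add.subgroupI)
        show "F N \<noteq> {}" using I I.zero_closed by blast
      qed (use sub pl mi in auto)
      show "x \<otimes> a \<in> F N" "a \<otimes> x \<in> F N" if "a \<in> F N" "x \<in> carrier R" for a x
        using sm[of x a] that sub by (auto simp: R.m_comm)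
    qed (rule R.ring_axioms)
    then show ?thesis using I by simp
  qed
  have Fs: "F N \<subset> F N'" if N: "submodule N R (quot_module R I)" "submodule N' R (quot_module R I)"
    and lt: "N \<subset> N'" for N N'
  proof -
    have "N' \<subseteq> carrier (quot_module R I)" using M.submoduleE(1)[OF N(2)] .
    moreover obtain X where "X \<in> N' - N" using lt by blast
    ultimately obtain x where "x \<in> carrier R" "I +> x \<in> N' - N" using carr by auto
    then show ?thesis using lt by (auto simp: F_def)
  qed
  have G: "submodule (G J) R (quot_module R I)" if J: "ideal J R \<and> I \<subseteq> J" for J
  proof -
    interpret J: ideal J R using J by simp
    have sm: "r \<odot>\<^bsub>quot_module R I\<^esub> X \<in> G J" if "r \<in> carrier R" "X \<in> G J" for r X
      using that smult J.I_l_closed J.a_subset by (auto simp: G_def)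
    show ?thesis
    proof (rule M.submoduleI)
      show G: "G J \<subseteq> carrier (quot_module R I)" using J.a_subset by (auto simp: carr G_def)
      show "\<zero>\<^bsub>quot_module R I\<^esub> \<in> G J"
        using I.a_rcos_const[OF I.zero_closed] J.zero_closed unfolding zer G_def by blast
      show "\<ominus>\<^bsub>quot_module R I\<^esub> a \<in> G J" if "a \<in> G J" for a
        using sm[of "\<ominus> \<one>" a] that G by (auto simp: M.smult_l_minus)
      show "a \<oplus>\<^bsub>quot_module R I\<^esub> b \<in> G J" if "a \<in> G J" "b \<in> G J" for a b
        using that add J.a_closed J.a_subset by (auto simp: G_def)
    qed (rule sm)
  qed
  have Gs: "G J \<subset> G J'" if J: "ideal J R \<and> I \<subseteq> J" "ideal J' R \<and> I \<subseteq> J'" "J \<subset> J'" for J J'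
  proof -
    interpret J: ideal J R using J by simp
    interpret J': ideal J' R using J by simp
    obtain x where x: "x \<in> J'" "x \<notin> J" using J by blast
    have "I +> x \<notin> G J"
    proof
      assume "I +> x \<in> G J"
      then obtain y where y: "y \<in> J" "I +> x = I +> y" by (auto simp: G_def)
      have xy: "x \<in> carrier R" "y \<in> carrier R" using x y by auto
      have "x \<ominus> y \<in> J" using y eq_iff[OF xy] J by auto
      then have "(x \<ominus> y) \<oplus> y \<in> J" using y by blast
      also have "(x \<ominus> y) \<oplus> y = x" using xy by algebra
      finally show False using x by simp
    qed
    then show ?thesis using x J by (auto simp: G_def)
  qed
  show ?thesis
    unfolding module_length_def
    by (intro antisym sup_chain_length_mono_map[of _ _ F] sup_chain_length_mono_map[of _ _ G] F Fs G Gs)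
qed

section \<open>Transporting a subring along an injection\<close>

text \<open>The ring is built inside a type of power series, with type class operations, while the
  theorem asks for a ring record on \<open>nat \<Rightarrow> nat\<close>. Copying a subring along an
  injection bridges the two, and later arguments about ideals stay on the type class side.\<close>

locale subring_copy =
  fixes A :: "'b :: comm_ring_1 set" and h :: "'b \<Rightarrow> 'a"
  assumes inj_h: "inj h"
    and one_A: "1 \<in> A"
    and add_A: "a \<in> A \<Longrightarrow> b \<in> A \<Longrightarrow> a + b \<in> A"
    and uminus_A: "a \<in> A \<Longrightarrow> - a \<in> A"
    and mult_A: "a \<in> A \<Longrightarrow> b \<in> A \<Longrightarrow> a * b \<in> A"
begin

definition copy :: "'a ring" where
  "copy = \<lparr>carrier = h ` A, mult = (\<lambda>x y. h (inv_into UNIV h x * inv_into UNIV h y)), one = h 1,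
           zero = h 0, add = (\<lambda>x y. h (inv_into UNIV h x + inv_into UNIV h y))\<rparr>"

text \<open>Closure under negatives comes from multiplication by -1, an element of
  \<open>A\<close>.\<close>

definition is_ideal :: "'b set \<Rightarrow> bool" where
  "is_ideal J \<longleftrightarrow> J \<subseteq> A \<and> 0 \<in> J \<and> (\<forall>a\<in>J. \<forall>b\<in>J. a + b \<in> J) \<and> (\<forall>r\<in>A. \<forall>a\<in>J. r * a \<in> J)"

lemma zero_A: "0 \<in> A"
  using add_A[OF one_A uminus_A[OF one_A]] by simp

lemma copy_simps [simp]:
  "carrier copy = h ` A" "\<one>\<^bsub>copy\<^esub> = h 1" "\<zero>\<^bsub>copy\<^esub> = h 0"
  "h a \<otimes>\<^bsub>copy\<^esub> h b = h (a * b)" "h a \<oplus>\<^bsub>copy\<^esub> h b = h (a + b)"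
  using inj_h by (simp_all add: copy_def)

lemma h_eq_iff [simp]: "h a = h b \<longleftrightarrow> a = b"
  using inj_h by (simp add: inj_eq)

lemma h_mem_iff [simp]: "h a \<in> h ` J \<longleftrightarrow> a \<in> J"
  using inj_h by (rule inj_image_mem_iff)

lemma h_subset_iff [simp]: "h ` I \<subseteq> h ` J \<longleftrightarrow> I \<subseteq> J"
  using inj_h by (rule inj_image_subset_iff)

lemma cring_copy: "cring copy"
proof (rule cringI)
  show "abelian_group copy"
  proof (rule abelian_groupI)
    show "\<exists>y\<in>carrier copy. y \<oplus>\<^bsub>copy\<^esub> x = \<zero>\<^bsub>copy\<^esub>" if "x \<in> carrier copy" for x
    proof -
      obtain a where "x = h a" "a \<in> A" using \<open>x \<in> carrier copy\<close> by auto
      then show ?thesis using uminus_A[of a] by (intro bexI[of _ "h (- a)"]) auto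
    qed
  qed (auto simp: add_A zero_A ac_simps)
  show "comm_monoid copy"
    by (rule comm_monoidI) (auto simp: mult_A one_A ac_simps)
qed (auto simp: algebra_simps)

sublocale copy: cring copy by (rule cring_copy)

lemma copy_nat_pow: "a \<in> A \<Longrightarrow> h a [^]\<^bsub>copy\<^esub> (k::nat) = h (a ^ k)"
  by (induction k) (auto simp: mult.commute)

lemma copy_add_pow: "[(k::nat)] \<cdot>\<^bsub>copy\<^esub> \<one>\<^bsub>copy\<^esub> = h (of_nat k)"
  using one_A by (induction k) (auto simp: add.commute copy.add.nat_pow_Suc)

lemma ring_char_copy: "ring_char copy = CHAR('b)"
proof -
  have "{k. [k] \<cdot>\<^bsub>copy\<^esub> \<one>\<^bsub>copy\<^esub> = \<zero>\<^bsub>copy\<^esub>} = {k. CHAR('b) dvd k}"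
    unfolding copy_add_pow by (simp add: of_nat_eq_0_iff_char_dvd)
  moreover have "Gcd {k. CHAR('b) dvd k} = CHAR('b)"
    by (rule dvd_antisym) (auto intro: Gcd_dvd Gcd_greatest)
  ultimately show ?thesis by (simp add: ring_char_def)
qed

lemma is_idealD:
  assumes "is_ideal J"
  shows "J \<subseteq> A" "0 \<in> J" "\<And>a b. a \<in> J \<Longrightarrow> b \<in> J \<Longrightarrow> a + b \<in> J"
    "\<And>r a. r \<in> A \<Longrightarrow> a \<in> J \<Longrightarrow> r * a \<in> J" "\<And>a b. a \<in> J \<Longrightarrow> b \<in> J \<Longrightarrow> a - b \<in> J"
    "\<And>r a. r \<in> A \<Longrightarrow> a \<in> J \<Longrightarrow> a * r \<in> J"
proof -
  show *: "J \<subseteq> A" "0 \<in> J" "\<And>a b. a \<in> J \<Longrightarrow> b \<in> J \<Longrightarrow> a + b \<in> J"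
    "\<And>r a. r \<in> A \<Longrightarrow> a \<in> J \<Longrightarrow> r * a \<in> J"
    using assms by (auto simp: is_ideal_def)
  show "a - b \<in> J" if "a \<in> J" "b \<in> J" for a b
    using *(3)[OF that(1) *(4)[OF uminus_A[OF one_A] that(2)]] by simp
  show "a * r \<in> J" if "r \<in> A" "a \<in> J" for r a
    using *(4)[OF that] by (simp add: mult.commute)
qed

lemma is_ideal_A: "is_ideal A"
  by (auto simp: is_ideal_def zero_A add_A mult_A)

lemma is_ideal_0: "is_ideal {0}"
  by (auto simp: is_ideal_def zero_A)

lemma ideal_copy_image: "is_ideal J \<Longrightarrow> ideal (h ` J) copy"
proof (rule idealI)
  assume J: "is_ideal J"
  note D = is_idealD[OF J]
  show "subgroup (h ` J) (add_monoid copy)"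
  proof (rule copy.add.subgroupI)
    show "\<ominus>\<^bsub>copy\<^esub> a \<in> h ` J" if "a \<in> h ` J" for a
    proof -
      obtain b where b: "a = h b" "b \<in> J" using \<open>a \<in> h ` J\<close> by blast
      have "- b \<in> J" using D(4)[OF uminus_A[OF one_A] b(2)] by simp
      moreover have "\<ominus>\<^bsub>copy\<^esub> a = h (- b)"
        using b D \<open>- b \<in> J\<close> by (intro copy.minus_equality) auto
      ultimately show ?thesis by simp
    qed
  qed (use D in auto)
qed (use is_idealD[of J] in \<open>auto simp: copy.ring_axioms\<close>)

lemma ideal_copyE:
  assumes "ideal I copy"
  obtains J where "I = h ` J" "is_ideal J"
proof
  interpret I: ideal I copy by fact
  show eq: "I = h ` (h -` I)" using I.a_subset by auto
  show "is_ideal (h -` I)"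
    unfolding is_ideal_def
  proof (intro conjI ballI subsetI)
    show "a \<in> A" if "a \<in> h -` I" for a using that I.a_subset by auto
    show "0 \<in> h -` I" using I.zero_closed by simp
    show "a + b \<in> h -` I" if "a \<in> h -` I" "b \<in> h -` I" for a b
      using that I.a_closed[of "h a" "h b"] by simp
    show "r * a \<in> h -` I" if "a \<in> h -` I" "r \<in> A" for a r
      using that I.I_l_closed[of "h a" "h r"] by simp
  qed
qed

lemma ideal_copy_iff: "ideal (h ` J) copy \<longleftrightarrow> is_ideal J"
  by (metis ideal_copyE ideal_copy_image inj_h inj_image_eq_iff)

text \<open>That \<open>S\<close> generates \<open>J\<close> is expressed by minimality among the
  ideals containing \<open>S\<close>, so no linear combinations have to be formed.\<close>

lemma noetherian_copyI:
  assumes "\<And>J. is_ideal J \<Longrightarrow> \<exists>S\<subseteq>J. finite S \<and> (\<forall>J'. is_ideal J' \<and> S \<subseteq> J' \<longrightarrow> J \<subseteq> J')"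
  shows "noetherian_ring copy"
proof (rule copy.noetherian_ringI)
  fix I assume "ideal I copy"
  then obtain J where J: "I = h ` J" "is_ideal J" by (rule ideal_copyE)
  obtain S where S: "S \<subseteq> J" "finite S" "\<forall>J'. is_ideal J' \<and> S \<subseteq> J' \<longrightarrow> J \<subseteq> J'"
    using assms[OF J(2)] by blast
  have SA: "h ` S \<subseteq> carrier copy" using S(1) is_idealD(1)[OF J(2)] by auto
  obtain J' where J': "Idl\<^bsub>copy\<^esub> (h ` S) = h ` J'" "is_ideal J'"
    using copy.genideal_ideal[OF SA] by (rule ideal_copyE)
  have "h ` S \<subseteq> h ` J'" using copy.genideal_self[OF SA] J' by simp
  then have "S \<subseteq> J'" by auto
  then have "I \<subseteq> Idl\<^bsub>copy\<^esub> (h ` S)" using S J J' by auto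
  moreover have "Idl\<^bsub>copy\<^esub> (h ` S) \<subseteq> I"
    using copy.genideal_minimal[OF \<open>ideal I copy\<close>] S(1) J(1) by blast
  ultimately show "\<exists>B\<subseteq>carrier copy. finite B \<and> I = Idl\<^bsub>copy\<^esub> B"
    using SA S(2) by (intro exI[of _ "h ` S"]) auto
qed

text \<open>The hypothesis \<open>max\<close> puts every proper ideal inside \<open>m\<close>, which
  yields maximality and uniqueness at once.\<close>

lemma local_ring_copyI:
  assumes m: "is_ideal m" "m \<noteq> A" and max: "\<And>J. is_ideal J \<Longrightarrow> \<not> J \<subseteq> m \<Longrightarrow> J = A"
  shows "local_ring copy (h ` m)"
  unfolding local_ring_def
proof (intro conjI allI impI)
  have m_A: "h ` m \<noteq> carrier copy" using m(2) by (simp add: inj_image_eq_iff[OF inj_h])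
  have *: "I \<subseteq> h ` m \<or> I = carrier copy" if I: "ideal I copy" for I
    using I by (rule ideal_copyE) (use max in auto)
  show "maximalideal (h ` m) copy"
  proof (rule maximalidealI)
    show "ideal (h ` m) copy" using m(1) by (simp add: ideal_copy_iff)
    show "J = h ` m \<or> J = carrier copy" if "ideal J copy" "h ` m \<subseteq> J" for J
      using *[OF that(1)] that(2) by blast
  qed (use m_A in blast)
  show "n = h ` m" if n: "maximalideal n copy" for n
  proof -
    interpret n: maximalideal n copy by fact
    have "n \<subseteq> h ` m" using *[OF n.is_ideal] n.I_notcarr by auto
    then show ?thesis
      using n.I_maximal[of "h ` m"] ideal_copy_iff[of m] m m_A is_idealD(1)[OF m(1)] by auto
  qed
qed (rule cring_copy)

lemma module_length_copy:
  assumes "is_ideal I"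
  shows "module_length copy (quot_module copy (h ` I)) = sup_chain_length (\<lambda>J. is_ideal J \<and> I \<subseteq> J)"
  unfolding module_length_quot_module[OF cring_copy ideal_copy_image[OF assms]]
proof (intro antisym sup_chain_length_mono_map[of _ _ "\<lambda>I. h -` I"]
    sup_chain_length_mono_map[of _ _ "\<lambda>J. h ` J"])
  have *: "is_ideal (h -` J) \<and> h ` (h -` J) = J" if "ideal J copy" for J
    using that by (rule ideal_copyE) (simp add: inj_vimage_image_eq[OF inj_h])
  show "is_ideal (h -` J) \<and> I \<subseteq> h -` J" if "ideal J copy \<and> h ` I \<subseteq> J" for J
    using that * by auto
  show "h -` J \<subset> h -` J'" if "ideal J copy \<and> h ` I \<subseteq> J" "ideal J' copy \<and> h ` I \<subseteq> J'" "J \<subset> J'"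
    for J J' using that *[of J] *[of J'] by (metis image_mono psubset_eq subset_refl vimage_mono)
qed (auto simp: ideal_copy_iff inj_image_eq_iff[OF inj_h] psubset_eq)

lemma frobenius_power_copy:
  assumes m: "m \<subseteq> A" and I: "is_ideal I" and pw: "\<And>f. f \<in> m \<Longrightarrow> f ^ q \<in> I"
    and min: "\<And>J. is_ideal J \<Longrightarrow> (\<And>f. f \<in> m \<Longrightarrow> f ^ q \<in> J) \<Longrightarrow> I \<subseteq> J"
  shows "frobenius_power copy (h ` m) q = h ` I"
proof -
  let ?S = "{r [^]\<^bsub>copy\<^esub> q |r. r \<in> h ` m}"
  have S: "?S = (\<lambda>f. h (f ^ q)) ` m" using m by (force simp: copy_nat_pow subset_iff)
  have SA: "?S \<subseteq> carrier copy"
    unfolding S using pw is_idealD(1)[OF I] by auto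
  obtain J where J: "Idl\<^bsub>copy\<^esub> ?S = h ` J" "is_ideal J"
    using copy.genideal_ideal[OF SA] by (rule ideal_copyE)
  have "f ^ q \<in> J" if "f \<in> m" for f
  proof -
    have "?S \<subseteq> h ` J" using copy.genideal_self[OF SA] by (simp only: J(1))
    then show ?thesis using that unfolding S by (auto simp: image_subset_iff)
  qed
  then have "I \<subseteq> J" using min J by blast
  moreover have "Idl\<^bsub>copy\<^esub> ?S \<subseteq> h ` I"
    by (rule copy.genideal_minimal) (use I pw S in \<open>auto simp: ideal_copy_iff\<close>)
  ultimately show ?thesis unfolding frobenius_power_def J(1) by auto
qed

text \<open>The hypotheses leave exactly two primes, zero and \<open>m\<close>, so the chain formed
  by these two is the longest.\<close>

lemma krull_dim_copy_1:
  assumes m: "is_ideal m" "m \<noteq> A" "m \<noteq> {0}"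
    and m_prime: "\<And>a b. a \<in> A \<Longrightarrow> b \<in> A \<Longrightarrow> a * b \<in> m \<Longrightarrow> a \<in> m \<or> b \<in> m"
    and zero_prime: "\<And>a b. a \<in> A \<Longrightarrow> b \<in> A \<Longrightarrow> a * b = 0 \<Longrightarrow> a = 0 \<or> b = 0"
    and dim: "\<And>P. is_ideal P \<Longrightarrow> P \<noteq> A \<Longrightarrow> P \<noteq> {0} \<Longrightarrow>
      (\<And>a b. a \<in> A \<Longrightarrow> b \<in> A \<Longrightarrow> a * b \<in> P \<Longrightarrow> a \<in> P \<or> b \<in> P) \<Longrightarrow> P = m"
  shows "krull_dim copy = 1"
proof -
  have A0: "A \<noteq> {0}" using m is_idealD(1,2)[OF m(1)] by auto
  have pm: "primeideal (h ` m) copy"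
  proof (rule primeidealI)
    show "carrier copy \<noteq> h ` m" using m(2) by (auto simp: inj_image_eq_iff[OF inj_h])
    show "a \<in> h ` m \<or> b \<in> h ` m"
      if ab: "a \<in> carrier copy" "b \<in> carrier copy" "a \<otimes>\<^bsub>copy\<^esub> b \<in> h ` m" for a b
    proof -
      obtain x y where "a = h x" "b = h y" "x \<in> A" "y \<in> A" using ab(1,2) by auto
      then show ?thesis using m_prime[of x y] ab(3) by simp
    qed
  qed (use m in \<open>auto simp: ideal_copy_iff cring_copy\<close>)
  have p0: "primeideal (h ` {0}) copy"
  proof (rule primeidealI)
    show "ideal (h ` {0}) copy" using is_ideal_0 ideal_copy_iff by blast
    show "carrier copy \<noteq> h ` {0}" using A0 inj_image_eq_iff[OF inj_h, of A "{0}"] by auto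
    show "a \<in> h ` {0} \<or> b \<in> h ` {0}"
      if ab: "a \<in> carrier copy" "b \<in> carrier copy" "a \<otimes>\<^bsub>copy\<^esub> b \<in> h ` {0}" for a b
    proof -
      obtain x y where "a = h x" "b = h y" "x \<in> A" "y \<in> A" using ab(1,2) by auto
      then show ?thesis using zero_prime[of x y] ab(3) by auto
    qed
  qed (rule cring_copy)
  have *: "P = h ` m" if P: "primeideal P copy" "P \<noteq> h ` {0}" for P
  proof -
    interpret P: primeideal P copy by fact
    obtain J where J: "P = h ` J" "is_ideal J" using P.is_ideal by (rule ideal_copyE)
    have "J = m"
    proof (rule dim[OF J(2)])
      show "J \<noteq> A" "J \<noteq> {0}" using P.I_notcarr P(2) J(1) by auto
      show "a \<in> J \<or> b \<in> J" if "a \<in> A" "b \<in> A" "a * b \<in> J" for a b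
        using P.I_prime[of "h a" "h b"] that J(1) by auto
    qed
    then show ?thesis using J by simp
  qed
  have "krull_dim copy = enat 1"
    unfolding krull_dim_def
  proof (rule sup_chain_length_eqI[of _ _ "\<lambda>i. if i = 0 then h ` {0} else h ` m"])
    show "\<forall>i\<le>1. primeideal (if i = 0 then h ` {0} else h ` m) copy" using pm p0 by simp
    show "\<forall>i<1. (if i = 0 then h ` {0} else h ` m) \<subset> (if Suc i = 0 then h ` {0} else h ` m)"
    proof -
      have "{0} \<subset> m" using m is_idealD(2)[OF m(1)] by auto
      then show ?thesis using h_subset_iff[of "{0}" m] h_subset_iff[of m "{0}"] by auto
    qed
    show "k \<le> 1" if C: "\<forall>i\<le>k. primeideal (C i) copy" "\<forall>i<k. C i \<subset> C (Suc i)" for k C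
    proof (rule ccontr)
      assume "\<not> k \<le> 1"
      then have p: "primeideal (C 0) copy" "primeideal (C 1) copy" "primeideal (C 2) copy"
        and lt: "C 0 \<subset> C 1" "C 1 \<subset> C 2" using C by (auto simp: numeral_2_eq_2)
      \<comment> \<open>Both \<open>C 1\<close> and \<open>C 2\<close> strictly contain a set
        holding zero, so both are the nonzero prime, contrary to strictness.\<close>
      have "h 0 \<in> C 0"
        using additive_subgroup.zero_closed[OF ideal.axioms(1)[OF primeideal.axioms(1)[OF p(1)]]]
        by simp
      then have "C 1 \<noteq> h ` {0}" "C 2 \<noteq> h ` {0}" using lt by auto
      then show False using *[OF p(2)] *[OF p(3)] lt by auto
    qed
  qed
  then show ?thesis by (simp add: one_enat_def)
qed

end

section \<open>Power series with graded support\<close>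

text \<open>These rules would turn \<open>\<noteq> 0\<close> into \<open>= 1\<close> for bits,
  whereas supports are described by \<open>\<noteq> 0\<close> throughout.\<close>

declare bit_not_zero_iff [simp del] bit_not_one_iff [simp del]

text \<open>Convolution in support form: if all terms of the sum vanished, so would the
  coefficient.\<close>

lemma fls_mult_nth_nonzeroE:
  fixes f g :: "'a::semiring_0 fls"
  assumes "(f * g) $$ k \<noteq> 0"
  obtains i j where "i + j = k" "f $$ i \<noteq> 0" "g $$ j \<noteq> 0"
proof -
  have "\<exists>i. f $$ i * g $$ (k - i) \<noteq> 0"
    using assms unfolding fls_times_nth(2) by (meson sum.not_neutral_contains_not_neutral)
  then obtain i where "f $$ i * g $$ (k - i) \<noteq> 0" by blast
  then show thesis by (intro that[of i "k - i"]) auto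
qed

lemma fls_fps_mult_nth_nonzeroE:
  fixes f g :: "'a::semiring_0 fls fps"
  assumes "(f * g) $ d $$ k \<noteq> 0"
  obtains d1 d2 k1 k2 where "d1 + d2 = d" "k1 + k2 = k" "f $ d1 $$ k1 \<noteq> 0" "g $ d2 $$ k2 \<noteq> 0"
proof -
  have "(\<Sum>i=0..d. (f $ i * g $ (d - i)) $$ k) \<noteq> 0"
    using assms by (simp add: fps_mult_nth fls_nth_sum)
  then obtain i where i: "i \<in> {0..d}" "(f $ i * g $ (d - i)) $$ k \<noteq> 0"
    by (rule sum.not_neutral_contains_not_neutral)
  from i(2) obtain k1 k2 where "k1 + k2 = k" "f $ i $$ k1 \<noteq> 0" "g $ (d - i) $$ k2 \<noteq> 0"
    by (rule fls_mult_nth_nonzeroE)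
  then show thesis using i(1) by (intro that[of i "d - i" k1 k2]) simp_all
qed

lemma fls_fps_eqI:
  fixes f g :: "'a::zero fls fps"
  assumes "\<And>d k. f $ d $$ k = g $ d $$ k"
  shows "f = g"
  using assms by (auto intro!: fps_ext fls_eqI)

text \<open>An element of K[[t]] is a family of bits indexed by a natural number and an integer. The
  pairing functions turn it into a 0-1 function on the naturals.\<close>

definition enc :: "bit fls fps \<Rightarrow> nat \<Rightarrow> nat" where
  "enc f m = of_bool (f $ fst (prod_decode m) $$ int_decode (snd (prod_decode m)) = 1)"

lemma inj_enc: "inj enc"
proof
  fix f g assume *: "enc f = enc g"
  show "f = g"
  proof (rule fls_fps_eqI)
    fix d k
    show "f $ d $$ k = g $ d $$ k"
      using fun_cong[OF *, of "prod_encode (d, int_encode k)"]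
      by (cases "f $ d $$ k"; cases "g $ d $$ k") (auto simp: enc_def)
  qed
qed

lemma CHAR_bit: "CHAR(bit) = 2"
proof -
  have "(of_nat 2 :: bit) = 0" by (simp add: numeral_2_eq_2 del: of_nat_numeral)
  then have "CHAR(bit) dvd 2" by (simp only: of_nat_eq_0_iff_char_dvd)
  moreover have "CHAR(bit) \<noteq> 1"
    using of_nat_CHAR[where 'a = bit] by auto
  ultimately show ?thesis using two_is_prime_nat by (auto simp: prime_nat_iff)
qed

lemma CHAR_bit_fls_fps: "CHAR(bit fls fps) = 2"
  by (simp add: CHAR_bit)

text \<open>Everything in this locale holds for arbitrary positive \<open>n\<close>; the choice n =
  2^pi + 1 enters only in the final theorem.\<close>

locale graded_curve =
  fixes n :: nat
  assumes n_pos: "n > 0"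
begin

text \<open>The coefficient of \<open>u^k t^d\<close> is filed under the number \<open>pos d k\<close>, which encodes \<open>d\<close>
  and the residue of \<open>k\<close> modulo \<open>n\<close> and orders first by \<open>d\<close>. The monomial \<open>x^a y^b\<close>
  is \<open>u^b t^(a + b)\<close>.\<close>

definition pos :: "nat \<Rightarrow> int \<Rightarrow> nat" where
  "pos d k = d * n + nat (k mod int n)"

definition idx :: "nat \<Rightarrow> nat \<Rightarrow> nat" where
  "idx a b = pos (a + b) (int b)"

abbreviation "indices \<equiv> range (case_prod idx)"

text \<open>\<open>supp_in indices\<close> is the ring R = k[[t, u t]] itself: in degree d it allows
  the classes of the exponents b <= d of u.\<close>

definition supp_in :: "nat set \<Rightarrow> bit fls fps set" where
  "supp_in X = {f. \<forall>d k. f $ d $$ k \<noteq> 0 \<longrightarrow> pos d k \<in> X}"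

definition res :: "nat \<Rightarrow> bit fls \<Rightarrow> bit fls" where
  "res \<rho> c = Abs_fls (\<lambda>k. if nat (k mod int n) = \<rho> then c $$ k else 0)"

definition comp :: "nat \<Rightarrow> bit fls fps \<Rightarrow> bit fls" where
  "comp l f = res (l mod n) (f $ (l div n))"

definition mon :: "nat \<Rightarrow> nat \<Rightarrow> bit fls fps" where
  "mon a b = fps_const (fls_X ^ b) * fps_X ^ (a + b)"

text \<open>These play the role of leading monomials. A leading component lies in some k u^\<rho>,
  which is one-dimensional over k, so it is determined up to a scalar.\<close>

definition lead :: "bit fls fps set \<Rightarrow> nat set" where
  "lead C = {l. \<exists>f\<in>C. comp l f \<noteq> 0 \<and> (\<forall>i<l. comp i f = 0)}"

text \<open>This is the ideal t^c K[[t]] of the ambient ring.\<close>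

definition vanish :: "nat \<Rightarrow> bit fls fps set" where
  "vanish c = {f. \<forall>d<c. f $ d = 0}"

section \<open>Arithmetic of positions, and the scalar field k\<close>

lemma residue_less: "nat (k mod int n) < n"
  using n_pos by (simp add: nat_less_iff)

lemma pos_div: "pos d k div n = d" and pos_mod: "pos d k mod n = nat (k mod int n)"
  using residue_less[of k] by (simp_all add: pos_def)

lemma residue_eq_iff: "nat (k mod int n) = nat (k' mod int n) \<longleftrightarrow> k mod int n = k' mod int n"
  using n_pos by (simp add: nat_eq_iff)

lemma pos_eq_iff: "pos d k = pos d' k' \<longleftrightarrow> d = d' \<and> k mod int n = k' mod int n"
proof
  assume *: "pos d k = pos d' k'"
  show "d = d' \<and> k mod int n = k' mod int n"
    using arg_cong[OF *, of "\<lambda>l. l div n"] arg_cong[OF *, of "\<lambda>l. l mod n"]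
    by (simp add: pos_div pos_mod residue_eq_iff)
qed (simp add: pos_def)

lemma pos_add:
  assumes "pos d k = idx a b" "pos d' k' = idx a' b'"
  shows "pos (d + d') (k + k') = idx (a + a') (b + b')"
  using assms mod_add_cong[of k "int n" "int b" k' "int b'"]
  by (simp add: idx_def pos_eq_iff)

lemma res_nth [simp]: "res \<rho> c $$ k = (if nat (k mod int n) = \<rho> then c $$ k else 0)"
proof -
  obtain N where "\<forall>k<N. c $$ k = 0" by (elim fls_nth_vanishes_belowE)
  then show ?thesis unfolding res_def by (subst nth_Abs_fls_lower_bound[of N]) auto
qed

lemma res_diff: "res \<rho> (c - c') = res \<rho> c - res \<rho> c'"
  by (rule fls_eqI) auto

text \<open>The subfield \<open>k = F_2((u^n))\<close> of \<open>K\<close>; \<open>res \<rho>\<close> is the \<open>k\<close>-linear projection to \<open>k u^\<rho>\<close>.\<close>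

definition scalar :: "bit fls \<Rightarrow> bool" where
  "scalar a \<longleftrightarrow> (\<forall>k. a $$ k \<noteq> 0 \<longrightarrow> k mod int n = 0)"

lemma mod_eq_of_scalar:
  "i + j = k \<Longrightarrow> i mod int n = 0 \<Longrightarrow> k mod int n = j mod int n"
  using mod_add_left_eq[of i "int n" j] by auto

lemma res_mult_scalar:
  assumes "scalar a"
  shows "res \<rho> (a * c) = a * res \<rho> c"
proof (rule fls_eqI)
  fix k
  show "res \<rho> (a * c) $$ k = (a * res \<rho> c) $$ k"
  proof (cases "nat (k mod int n) = \<rho>")
    case True
    \<comment> \<open>The part of \<open>c\<close> outside the class \<rho> stays outside it after
      multiplication by a scalar.\<close>
    have "(a * (c - res \<rho> c)) $$ k = 0"
    proof (rule ccontr)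
      assume "(a * (c - res \<rho> c)) $$ k \<noteq> 0"
      then obtain i j where ij: "i + j = k" "a $$ i \<noteq> 0" "(c - res \<rho> c) $$ j \<noteq> 0"
        by (rule fls_mult_nth_nonzeroE)
      then show False
        using assms mod_eq_of_scalar[OF ij(1)] True by (auto simp: scalar_def split: if_splits)
    qed
    moreover have "a * c = a * res \<rho> c + a * (c - res \<rho> c)" by (simp add: algebra_simps)
    ultimately have "(a * c) $$ k = (a * res \<rho> c) $$ k" by (metis add.right_neutral fls_plus_nth)
    then show ?thesis using True by simp
  next
    case False
    have "(a * res \<rho> c) $$ k = 0"
    proof (rule ccontr)
      assume "(a * res \<rho> c) $$ k \<noteq> 0"
      then obtain i j where ij: "i + j = k" "a $$ i \<noteq> 0" "(res \<rho> c) $$ j \<noteq> 0"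
        by (rule fls_mult_nth_nonzeroE)
      then show False
        using assms mod_eq_of_scalar[OF ij(1)] False by (auto simp: scalar_def split: if_splits)
    qed
    then show ?thesis using False by simp
  qed
qed

text \<open>Two elements of the line k u^\<rho> differ by a factor in k. Concretely, the quotient
  \<open>w\<close> multiplies \<open>res \<rho> b\<close> into the class \<rho>, to which only the
  class-0 part of \<open>w\<close> contributes; cancelling in the field K gives
  \<open>w = res 0 w\<close>.\<close>

lemma scalar_quotient:
  assumes "res \<rho> b \<noteq> 0"
  shows "scalar (res \<rho> c / res \<rho> b)"
proof -
  define w where "w = res \<rho> c / res \<rho> b"
  have w: "res \<rho> c = w * res \<rho> b" using assms by (simp add: w_def)
  have "res \<rho> c = res 0 w * res \<rho> b"
  proof (rule fls_eqI)
    fix k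
    show "res \<rho> c $$ k = (res 0 w * res \<rho> b) $$ k"
    proof (cases "nat (k mod int n) = \<rho>")
      case True
      have "((w - res 0 w) * res \<rho> b) $$ k = 0"
      proof (rule ccontr)
        assume "((w - res 0 w) * res \<rho> b) $$ k \<noteq> 0"
        then obtain i j where ij: "i + j = k" "(w - res 0 w) $$ i \<noteq> 0" "(res \<rho> b) $$ j \<noteq> 0"
          by (rule fls_mult_nth_nonzeroE)
        then have "k mod int n = j mod int n" "i mod int n \<noteq> 0"
          using True residue_eq_iff[of j k] by (auto split: if_splits)
        moreover have "i mod int n = (k - j) mod int n" using ij(1) by auto
        ultimately show False by (metis mod_diff_cong cancel_comm_monoid_add_class.diff_cancel mod_0)
      qed
      moreover have "w * res \<rho> b = res 0 w * res \<rho> b + (w - res 0 w) * res \<rho> b"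
        by (simp add: algebra_simps)
      ultimately show ?thesis unfolding w by (metis add.right_neutral fls_plus_nth)
    next
      case False
      have "(res 0 w * res \<rho> b) $$ k = 0"
      proof (rule ccontr)
        assume "(res 0 w * res \<rho> b) $$ k \<noteq> 0"
        then obtain i j where ij: "i + j = k" "(res 0 w) $$ i \<noteq> 0" "(res \<rho> b) $$ j \<noteq> 0"
          by (rule fls_mult_nth_nonzeroE)
        then have "i mod int n = 0" "nat (j mod int n) = \<rho>"
          using n_pos by (auto split: if_splits simp: residue_eq_iff[of i 0, simplified])
        then show False using False mod_eq_of_scalar[OF ij(1)] by simp
      qed
      then show ?thesis using False by simp
    qed
  qed
  then have "w = res 0 w" using assms unfolding w by simp
  then have "scalar w"
    unfolding scalar_def by (metis nat_0 mod_0 res_nth residue_eq_iff)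
  then show ?thesis by (simp add: w_def)
qed

lemma comp_nth: "comp l f $$ k = (if pos (l div n) k = l then f $ (l div n) $$ k else 0)"
proof -
  have "nat (k mod int n) = l mod n \<longleftrightarrow> pos (l div n) k = l"
    by (metis div_mult_mod_eq pos_def pos_mod)
  then show ?thesis by (simp add: comp_def)
qed

lemma comp_eq_0_iff: "comp l f = 0 \<longleftrightarrow> (\<forall>d k. pos d k = l \<longrightarrow> f $ d $$ k = 0)"
  by (auto simp: fls_eq_iff comp_nth pos_div)

lemma supp_in_iff: "f \<in> supp_in X \<longleftrightarrow> (\<forall>d k. f $ d $$ k \<noteq> 0 \<longrightarrow> pos d k \<in> X)"
  by (simp add: supp_in_def)

lemma supp_in_comp: "f \<in> supp_in X \<Longrightarrow> comp l f \<noteq> 0 \<Longrightarrow> l \<in> X"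
  by (auto simp: comp_eq_0_iff supp_in_def)

section \<open>Monomials and supports of products\<close>

lemma idx_in_indices [simp]: "idx a b \<in> indices"
  by (rule range_eqI[of _ _ "(a, b)"]) simp

text \<open>This is stability under multiplication by monomials, on the level of positions.
  \<open>idx\<close> is not injective: x^n and y^n differ by the scalar u^n and share a
  position.\<close>

definition mon_ideal :: "nat set \<Rightarrow> bool" where
  "mon_ideal X \<longleftrightarrow> X \<subseteq> indices \<and>
     (\<forall>a b a' b'. idx a b \<in> X \<longrightarrow> idx (a + a') (b + b') \<in> X)"

lemma mon_ideal_indices: "mon_ideal indices"
  by (auto simp: mon_ideal_def)

text \<open>A nonzero coefficient of the product sits at a sum of positions of the factors. With
  \<open>X = indices\<close> this is closure of the ring under products, in general the ideal
  property.\<close>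

lemma supp_in_mult:
  assumes X: "mon_ideal X" and f: "f \<in> supp_in indices" and g: "g \<in> supp_in X"
  shows "f * g \<in> supp_in X"
  unfolding supp_in_iff
proof (intro allI impI)
  fix d k assume "(f * g) $ d $$ k \<noteq> 0"
  then obtain d1 d2 k1 k2
    where *: "d1 + d2 = d" "k1 + k2 = k" "f $ d1 $$ k1 \<noteq> 0" "g $ d2 $$ k2 \<noteq> 0"
    by (rule fls_fps_mult_nth_nonzeroE)
  have "pos d1 k1 \<in> indices" "pos d2 k2 \<in> X" using f g * by (auto simp: supp_in_iff)
  moreover have "X \<subseteq> indices" using X by (simp add: mon_ideal_def)
  ultimately obtain a b a' b' where ab: "pos d1 k1 = idx a b" "pos d2 k2 = idx a' b'" by auto
  have "idx (a' + a) (b' + b) \<in> X"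
    using X \<open>pos d2 k2 \<in> X\<close> unfolding ab mon_ideal_def by blast
  then show "pos d k \<in> X" using pos_add[OF ab] * by (simp add: add.commute)
qed

lemma supp_in_zero: "0 \<in> supp_in X"
  by (simp add: supp_in_def)

lemma supp_in_add: "f \<in> supp_in X \<Longrightarrow> g \<in> supp_in X \<Longrightarrow> f + g \<in> supp_in X"
  by (fastforce simp: supp_in_iff)

lemma supp_in_uminus: "f \<in> supp_in X \<Longrightarrow> - f \<in> supp_in X"
  by (simp add: supp_in_iff)

lemma supp_in_mono: "X \<subseteq> Y \<Longrightarrow> supp_in X \<subseteq> supp_in Y"
  by (auto simp: supp_in_def)

lemma mon_nth: "mon a b $ d $$ k = (if d = a + b \<and> k = int b then 1 else 0)"
  by (simp add: mon_def fps_X_power_nth)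

lemma mon_mult_nth: "(mon a b * f) $ d $$ k = (if a + b \<le> d then f $ (d - (a + b)) $$ (k - int b) else 0)"
proof -
  have "(mon a b * f) $ d = fls_X ^ b * (if d < a + b then 0 else f $ (d - (a + b)))"
    by (simp add: mon_def mult.assoc fps_X_power_mult_nth)
  then show ?thesis by (simp add: fls_X_power_times_conv_shift)
qed

lemma mon_in_iff: "mon a b \<in> supp_in X \<longleftrightarrow> idx a b \<in> X"
  by (auto simp: supp_in_iff mon_nth idx_def)

lemma mon_power: "mon a b ^ q = mon (a * q) (b * q)"
  by (simp add: mon_def power_mult_distrib fps_const_power algebra_simps flip: power_mult)

lemma mon_in_indices: "mon a b \<in> supp_in indices"
  by (auto simp: mon_in_iff)

lemma comp_mon: "comp l (mon a b) = 0 \<longleftrightarrow> l \<noteq> idx a b"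
  by (auto simp: comp_eq_0_iff mon_nth idx_def)

text \<open>From degree n on every residue b < n satisfies b <= d, so nothing is excluded: t^n
  K[[t]] lies in the conductor of R.\<close>

lemma vanish_subset_supp: "vanish n \<subseteq> supp_in indices"
proof
  fix f assume f: "f \<in> vanish n"
  show "f \<in> supp_in indices"
    unfolding supp_in_iff
  proof (intro allI impI)
    fix d k assume *: "f $ d $$ k \<noteq> 0"
    have "n \<le> d"
    proof (rule ccontr)
      assume "\<not> n \<le> d"
      then have "f $ d = 0" using f by (simp add: vanish_def)
      then show False using * by simp
    qed
    then have "pos d k = idx (d - nat (k mod int n)) (nat (k mod int n))"
      using residue_less[of k] n_pos by (simp add: idx_def pos_eq_iff)
    then show "pos d k \<in> indices" by auto
  qed
qed

text \<open>As K is a field, a nonzero \<open>f\<close> divides every series of at least its order,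
  and the orders of factors add up.\<close>

lemma vanish_subset_multiples:
  assumes "f \<noteq> 0"
  shows "vanish (subdegree f + c) \<subseteq> (\<lambda>g. g * f) ` vanish c"
proof
  fix g assume g: "g \<in> vanish (subdegree f + c)"
  show "g \<in> (\<lambda>g. g * f) ` vanish c"
  proof (cases "g = 0")
    case False
    have sg: "subdegree f + c \<le> subdegree g"
      using g False by (intro subdegree_geI) (auto simp: vanish_def)
    then have "f dvd g" using False assms by (simp add: fps_dvd_iff)
    then obtain h where h: "g = h * f" by (metis dvdE mult.commute)
    then have "subdegree g = subdegree h + subdegree f" using False by auto
    then have "h \<in> vanish c" using sg by (auto simp: vanish_def intro: nth_less_subdegree_zero)
    then show ?thesis using h by blast
  qed (auto intro!: image_eqI[of _ _ 0] simp: vanish_def)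
qed

section \<open>Ideals, elimination of leading positions, and the Noetherian property\<close>

sublocale subring_copy "supp_in indices" enc
proof
  show "1 \<in> supp_in indices" using mon_in_indices[of 0 0] by (simp add: mon_def)
  show "inj enc" by (rule inj_enc)
  show "f + g \<in> supp_in indices" if "f \<in> supp_in indices" "g \<in> supp_in indices" for f g
    using that by (rule supp_in_add)
  show "- f \<in> supp_in indices" if "f \<in> supp_in indices" for f
    using that by (rule supp_in_uminus)
  show "f * g \<in> supp_in indices" if "f \<in> supp_in indices" "g \<in> supp_in indices" for f g
    using mon_ideal_indices that by (rule supp_in_mult)
qed

lemma is_ideal_supp_in:
  assumes "mon_ideal X"
  shows "is_ideal (supp_in X)"
proof -
  have "X \<subseteq> indices" using assms by (simp add: mon_ideal_def)
  then show ?thesis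
    unfolding is_ideal_def
    by (intro conjI ballI supp_in_zero supp_in_mono supp_in_add supp_in_mult[OF assms])
qed

lemma scalar_in: "scalar a \<Longrightarrow> fps_const a \<in> supp_in indices"
proof -
  assume a: "scalar a"
  have "pos 0 k = idx 0 0" if "a $$ k \<noteq> 0" for k
    using a that by (simp add: scalar_def idx_def pos_eq_iff)
  then show ?thesis by (auto simp: supp_in_iff)
qed

text \<open>Elimination: subtracting scalar multiples of elements of \<open>C\<close> pushes the leading
  position of an element of \<open>C'\<close> into the range where everything already lies in \<open>C\<close>.\<close>

lemma ideal_eq_of_lead:
  assumes C: "is_ideal C" and C': "is_ideal C'" and sub: "C \<subseteq> C'" and van: "vanish c \<subseteq> C"
    and lead: "\<And>l. l < c * n \<Longrightarrow> l \<in> lead C' \<Longrightarrow> l \<in> lead C"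
  shows "C' = C"
proof -
  have "f \<in> C" if "f \<in> C'" "\<forall>i<l. comp i f = 0" for f l
    using that
  proof (induction "c * n - l" arbitrary: l f rule: less_induct)
    case less
    show ?case
    proof (cases "l < c * n")
      case False
      \<comment> \<open>A coefficient in degree below \<open>c\<close> has a position below
        \<open>c * n\<close>, hence below \<open>l\<close>, where all components vanish.\<close>
      have "f $ d $$ k = 0" if "d < c" for d k
      proof -
        have "pos d k < (d + 1) * n" using residue_less[of k] by (simp add: pos_def)
        also have "\<dots> \<le> c * n" using that by (intro mult_right_mono) auto
        finally show ?thesis using less.prems(2) False comp_eq_0_iff by (metis less_le_trans not_less)
      qed
      then have "f \<in> vanish c" by (auto simp: vanish_def intro: fls_eqI)
      then show ?thesis using van by blast
    next
      case True
      show ?thesis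
      proof (cases "comp l f = 0")
        case True
        then show ?thesis
          using less.hyps[of "Suc l" f] less.prems \<open>l < c * n\<close> by (auto simp: less_Suc_eq)
      next
        case False
        then have "l \<in> lead C'" using less.prems by (auto simp: lead_def)
        then obtain g where g: "g \<in> C" "comp l g \<noteq> 0" "\<forall>i<l. comp i g = 0"
          using lead[OF \<open>l < c * n\<close>] unfolding lead_def by blast
        \<comment> \<open>The factor that cancels the component at \<open>l\<close>; it is a scalar
          because both components belong to the same residue.\<close>
        define a where "a = comp l f / comp l g"
        have a: "scalar a" using g(2) unfolding a_def comp_def by (rule scalar_quotient)
        have cm: "comp i (f - fps_const a * g) = comp i f - a * comp i g" for i
          by (simp add: comp_def res_diff res_mult_scalar[OF a])
        have ag: "fps_const a * g \<in> C" using is_idealD(4)[OF C scalar_in[OF a] g(1)] .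
        have "f - fps_const a * g \<in> C"
        proof (rule less.hyps[of "Suc l"])
          show "f - fps_const a * g \<in> C'"
            using is_idealD(5)[OF C'] less.prems(1) ag sub by blast
          show "\<forall>i<Suc l. comp i (f - fps_const a * g) = 0"
            using g less.prems(2) by (auto simp: cm less_Suc_eq) (simp add: a_def)
        qed (use True in auto)
        from is_idealD(3)[OF C this ag] show ?thesis by simp
      qed
    qed
  qed
  from this[of _ 0] show ?thesis using sub by auto
qed

text \<open>The multipliers t^n K[[t]] of \<open>f\<close> all lie in R. Hence only finitely many
  positions matter for a nonzero ideal.\<close>

lemma vanish_subset_ideal:
  assumes "is_ideal J" "f \<in> J" "f \<noteq> 0"
  shows "vanish (subdegree f + n) \<subseteq> J"
  using vanish_subset_multiples[OF assms(3), of n] vanish_subset_supp is_idealD(4)[OF assms(1) _ assms(2)]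
  by blast

lemma lead_mono: "C \<subseteq> C' \<Longrightarrow> lead C \<subseteq> lead C'"
  by (auto simp: lead_def)

lemma lead_supp_in: "lead (supp_in X) \<subseteq> X"
  by (auto simp: lead_def dest: supp_in_comp)

lemma subset_lead_supp_in:
  assumes "X \<subseteq> indices"
  shows "X \<subseteq> lead (supp_in X)"
proof
  fix l assume "l \<in> X"
  moreover from this obtain a b where "l = idx a b" using assms by auto
  ultimately show "l \<in> lead (supp_in X)"
    using mon_in_iff[of a b X] comp_mon[of _ a b] unfolding lead_def by blast
qed

text \<open>Generators are one nonzero \<open>f\<close>, which accounts for all large degrees, and
  one element for each leading position below \<open>c * n\<close>.\<close>

lemma noetherian: "noetherian_ring copy"
proof (rule noetherian_copyI)
  fix J assume J: "is_ideal J"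
  show "\<exists>S\<subseteq>J. finite S \<and> (\<forall>J'. is_ideal J' \<and> S \<subseteq> J' \<longrightarrow> J \<subseteq> J')"
  proof (cases "J = {0}")
    case True
    then show ?thesis by (intro exI[of _ "{}"]) (auto dest: is_idealD(2))
  next
    case False
    then obtain f where f: "f \<in> J" "f \<noteq> 0" using is_idealD(2)[OF J] by blast
    define c where "c = subdegree f + n"
    have "\<forall>l\<in>lead J. \<exists>g. g \<in> J \<and> comp l g \<noteq> 0 \<and> (\<forall>i<l. comp i g = 0)"
      by (auto simp: lead_def)
    then obtain g where g: "\<forall>l\<in>lead J. g l \<in> J \<and> comp l (g l) \<noteq> 0 \<and> (\<forall>i<l. comp i (g l) = 0)"
      by metis
    define S where "S = insert f (g ` (lead J \<inter> {..<c * n}))"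
    have "J \<subseteq> J'" if J': "is_ideal J'" "S \<subseteq> J'" for J'
    proof -
      have SJ: "S \<subseteq> J \<inter> J'" using f(1) g J'(2) by (auto simp: S_def)
      \<comment> \<open>Elimination compares nested ideals, so \<open>J\<close> is compared with its
        intersection with \<open>J'\<close>.\<close>
      have I: "is_ideal (J \<inter> J')" using J J'(1) by (auto simp: is_ideal_def)
      have "J = J \<inter> J'"
      proof (rule ideal_eq_of_lead[OF I J])
        show "vanish c \<subseteq> J \<inter> J'"
          unfolding c_def using vanish_subset_ideal[OF I _ f(2)] SJ by (auto simp: S_def)
        show "l \<in> lead (J \<inter> J')" if "l < c * n" "l \<in> lead J" for l
        proof -
          have "g l \<in> J \<inter> J'" using SJ that by (auto simp: S_def)
          then show ?thesis using g that(2) unfolding lead_def by blast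
        qed
      qed auto
      then show ?thesis by blast
    qed
    moreover have "S \<subseteq> J" "finite S" using f g by (auto simp: S_def)
    ultimately show ?thesis by blast
  qed
qed

section \<open>The maximal ideal and the prime spectrum\<close>

definition max_ideal :: "bit fls fps set" where
  "max_ideal = supp_in (indices - {0})"

lemma idx_eq_0_iff: "idx a b = 0 \<longleftrightarrow> a = 0 \<and> b = 0"
  using pos_eq_iff[of "a + b" "int b" 0 0] by (auto simp: idx_def pos_def)

text \<open>In degree 0 the ring contains only scalars, all at position 0, so excluding this
  position removes the whole constant term.\<close>

lemma max_ideal_iff: "f \<in> max_ideal \<longleftrightarrow> f \<in> supp_in indices \<and> f $ 0 = 0"
proof -
  have "f $ 0 = 0 \<longleftrightarrow> (\<forall>d k. f $ d $$ k \<noteq> 0 \<longrightarrow> pos d k \<noteq> 0)" if "f \<in> supp_in indices"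
  proof
    assume "f $ 0 = 0"
    then show "\<forall>d k. f $ d $$ k \<noteq> 0 \<longrightarrow> pos d k \<noteq> 0"
      using n_pos by (intro allI impI) (metis add_is_0 fls_zero_nth mult_is_0 not_gr_zero pos_def)
  next
    assume *: "\<forall>d k. f $ d $$ k \<noteq> 0 \<longrightarrow> pos d k \<noteq> 0"
    have "f $ 0 $$ k = 0" for k
    proof (rule ccontr)
      assume k: "f $ 0 $$ k \<noteq> 0"
      then have "pos 0 k \<in> indices" using that by (auto simp: supp_in_iff)
      then obtain a b where ab: "pos 0 k = idx a b" by auto
      then have "a = 0 \<and> b = 0" by (auto simp: idx_def pos_eq_iff)
      then show False using *[rule_format, OF k] ab idx_eq_0_iff[of a b] by simp
    qed
    then show "f $ 0 = 0" by (auto intro: fls_eqI)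
  qed
  moreover have "f \<in> max_ideal \<longleftrightarrow>
      f \<in> supp_in indices \<and> (\<forall>d k. f $ d $$ k \<noteq> 0 \<longrightarrow> pos d k \<noteq> 0)"
    unfolding max_ideal_def supp_in_iff Diff_iff singleton_iff by iprover
  ultimately show ?thesis by iprover
qed

lemma mon_ideal_max: "mon_ideal (indices - {0})"
  unfolding mon_ideal_def using idx_in_indices
  by (simp add: idx_eq_0_iff)

lemma is_ideal_max: "is_ideal max_ideal"
  unfolding max_ideal_def by (rule is_ideal_supp_in[OF mon_ideal_max])

lemma max_ideal_neq: "max_ideal \<noteq> supp_in indices" "max_ideal \<noteq> {0}"
proof -
  have "1 \<notin> max_ideal" by (simp add: max_ideal_iff)
  then show "max_ideal \<noteq> supp_in indices" using one_A by metis
  have "mon 1 0 \<in> max_ideal"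
    unfolding max_ideal_iff using mon_in_indices[of 1 0] by (simp add: mon_def)
  moreover have "mon 1 0 \<noteq> 0" by (simp add: mon_def)
  ultimately show "max_ideal \<noteq> {0}" by blast
qed

text \<open>Some \<open>f\<close> in \<open>J\<close> has a nonzero scalar as constant term, so
  \<open>mon a b * f\<close> leads at \<open>idx a b\<close>. Thus every index is a leading position
  of \<open>J\<close>, and elimination applies without inverting \<open>f\<close>.\<close>

lemma ideal_eq_of_not_le_max:
  assumes J: "is_ideal J" "\<not> J \<subseteq> max_ideal"
  shows "J = supp_in indices"
proof -
  obtain f where f: "f \<in> J" "f \<notin> max_ideal" using J(2) by blast
  moreover from this have "f \<in> supp_in indices" using is_idealD(1)[OF J(1)] by auto
  ultimately have f: "f \<in> J" "f \<in> supp_in indices" "f $ 0 \<noteq> 0" by (simp_all add: max_ideal_iff)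
  then have "f \<noteq> 0" by auto
  have "supp_in indices = J"
  proof (rule ideal_eq_of_lead[OF J(1) is_ideal_A is_idealD(1)[OF J(1)]])
    show "vanish (subdegree f + n) \<subseteq> J" using vanish_subset_ideal J(1) f(1) \<open>f \<noteq> 0\<close> .
    fix l assume "l \<in> lead (supp_in indices)"
    then have "l \<in> indices" using lead_supp_in by blast
    then obtain a b where l: "l = idx a b" by auto
    obtain k0 where k0: "f $ 0 $$ k0 \<noteq> 0" using f(3) by (auto simp: fls_eq_iff)
    have k: "k mod int n = 0" if "f $ 0 $$ k \<noteq> 0" for k
    proof -
      have "pos 0 k \<in> indices" using that f(2) by (auto simp: supp_in_iff)
      then obtain a b where "pos 0 k = idx a b" by auto
      then show ?thesis by (auto simp: idx_def pos_eq_iff)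
    qed
    have "comp l (mon a b * f) \<noteq> 0"
    proof -
      have "pos (a + b) (int b + k0) = l"
        using mod_eq_of_scalar[of k0 "int b"] k[OF k0] by (simp add: l idx_def pos_eq_iff add.commute)
      moreover have "(mon a b * f) $ (a + b) $$ (int b + k0) \<noteq> 0" using k0 by (simp add: mon_mult_nth)
      ultimately show ?thesis using comp_eq_0_iff by blast
    qed
    moreover have "comp i (mon a b * f) = 0" if "i < l" for i
      unfolding comp_eq_0_iff
    proof (intro allI impI, rule ccontr)
      fix d k assume i: "pos d k = i" and nz: "(mon a b * f) $ d $$ k \<noteq> 0"
      \<comment> \<open>The product has order at least \<open>a + b\<close>, so only this degree
        remains, and there all its coefficients sit at position \<open>l\<close>.\<close>
      have "d \<le> a + b" using div_le_mono[of i l n] that i by (auto simp: l idx_def pos_div)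
      then have d: "d = a + b" "f $ 0 $$ (k - int b) \<noteq> 0" using nz by (auto simp: mon_mult_nth split: if_splits)
      then have "pos d k = l" using mod_eq_of_scalar[of "k - int b" "int b" k] k[OF d(2)]
        by (simp add: l idx_def pos_eq_iff)
      then show False using i that by simp
    qed
    moreover have "mon a b * f \<in> J" using is_idealD(4)[OF J(1) mon_in_indices f(1)] .
    ultimately show "l \<in> lead J" by (auto simp: lead_def)
  qed
  then show ?thesis by simp
qed

lemma local_ring: "local_ring copy (enc ` max_ideal)"
  by (rule local_ring_copyI[OF is_ideal_max max_ideal_neq(1) ideal_eq_of_not_le_max])

text \<open>A nonzero prime contains some t^c K[[t]], hence the c-th power of each series without
  constant term, hence the series itself if it is in R.\<close>

lemma krull_dim: "krull_dim copy = 1"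
proof (rule krull_dim_copy_1[OF is_ideal_max max_ideal_neq])
  show "f \<in> max_ideal \<or> g \<in> max_ideal"
    if "f \<in> supp_in indices" "g \<in> supp_in indices" "f * g \<in> max_ideal" for f g
    using that by (auto simp: max_ideal_iff)
next
  fix P assume P: "is_ideal P" "P \<noteq> supp_in indices" "P \<noteq> {0}"
    and prime: "\<And>f g. f \<in> supp_in indices \<Longrightarrow> g \<in> supp_in indices \<Longrightarrow> f * g \<in> P \<Longrightarrow> f \<in> P \<or> g \<in> P"
  have sub: "P \<subseteq> max_ideal" using ideal_eq_of_not_le_max[OF P(1)] P(2) by blast
  obtain f where f: "f \<in> P" "f \<noteq> 0" using P is_idealD(2)[OF P(1)] by blast
  define c where "c = subdegree f + n"
  have van: "vanish c \<subseteq> P" unfolding c_def by (rule vanish_subset_ideal[OF P(1) f])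
  have one: "1 \<notin> P" using sub max_ideal_iff[of 1] by auto
  have "g \<in> P" if g: "g \<in> max_ideal" for g
  proof -
    have gA: "g \<in> supp_in indices" "g $ 0 = 0" using g by (auto simp: max_ideal_iff)
    have pA: "g ^ i \<in> supp_in indices" for i by (induction i) (auto simp: one_A mult_A gA(1))
    have "g ^ c \<in> vanish c" using gA(2) startsby_zero_power_prefix[of g c] by (auto simp: vanish_def)
    then have "g ^ c \<in> P" using van by blast
    moreover have "g ^ i \<in> P \<Longrightarrow> g \<in> P" for i
      by (induction i) (use one prime[OF gA(1) pA] in auto)
    ultimately show ?thesis by blast
  qed
  then show "P = max_ideal" using sub by blast
qed auto

section \<open>Frobenius powers of the maximal ideal\<close>


text \<open>The positions of monomials in (x^q, y^q). A position may come from several pairs, and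
  one suitable pair is enough.\<close>

definition frob_idx :: "nat \<Rightarrow> nat set" where
  "frob_idx q = {idx a b | a b. a \<ge> q \<or> b \<ge> q}"

lemma idx_eq_iff: "idx a b = idx a' b' \<longleftrightarrow> a + b = a' + b' \<and> b mod n = b' mod n"
  by (simp add: idx_def pos_eq_iff flip: of_nat_mod)

lemma mon_ideal_frob: "mon_ideal (frob_idx q)"
  unfolding mon_ideal_def
proof (intro conjI allI impI)
  show "frob_idx q \<subseteq> indices" by (auto simp: frob_idx_def)
  fix a b a' b' assume "idx a b \<in> frob_idx q"
  then obtain c d where cd: "idx a b = idx c d" "c \<ge> q \<or> d \<ge> q" by (auto simp: frob_idx_def)
  have "idx (a + a') (b + b') = idx (c + a') (d + b')"
    using cd(1) by (auto simp: idx_eq_iff intro: mod_add_cong)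
  then show "idx (a + a') (b + b') \<in> frob_idx q"
    unfolding frob_idx_def using cd(2) trans_le_add1 by blast
qed

lemma Abs_fls_restrict_nth:
  fixes c :: "bit fls"
  shows "Abs_fls (\<lambda>k. if Q k then c $$ k else 0) $$ k = (if Q k then c $$ k else 0)"
proof -
  obtain N where "\<forall>k<N. c $$ k = 0" by (elim fls_nth_vanishes_belowE)
  then show ?thesis by (subst nth_Abs_fls_lower_bound[of N]) auto
qed

text \<open>The support is split in two: positions having a pair with a >= q are divided by x^q, and
  the others, which have a pair with b >= q, by y^q. Hence \<open>supp_in (frob_idx q)\<close> lies
  in the ideal (x^q, y^q).\<close>

lemma frob_idx_split:
  assumes f: "f \<in> supp_in (frob_idx q)"
  obtains g h where "g \<in> supp_in indices" "h \<in> supp_in indices" "f = mon q 0 * g + mon 0 q * h"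
proof -
  define Q where "Q d k \<longleftrightarrow> (\<exists>a b. a \<ge> q \<and> pos d k = idx a b)" for d k
  define g where "g = Abs_fps (\<lambda>d. Abs_fls (\<lambda>k. if Q (d + q) k then f $ (d + q) $$ k else 0))"
  \<comment> \<open>Division by y^q = u^q t^q also lowers the exponent of u by q, hence the
    shift.\<close>
  define h where "h = Abs_fps (\<lambda>d. Abs_fls (\<lambda>k. if \<not> Q (d + q) (k + int q)
    then fls_shift (int q) (f $ (d + q)) $$ k else 0))"
  have g_nth: "g $ d $$ k = (if Q (d + q) k then f $ (d + q) $$ k else 0)" for d k
    unfolding g_def fps_nth_Abs_fps by (rule Abs_fls_restrict_nth)
  have h_nth: "h $ d $$ k = (if \<not> Q (d + q) (k + int q) then f $ (d + q) $$ (k + int q) else 0)" for d k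
    unfolding h_def fps_nth_Abs_fps Abs_fls_restrict_nth by simp
  have "g \<in> supp_in indices"
    unfolding supp_in_iff
  proof (intro allI impI)
    fix d k assume "g $ d $$ k \<noteq> 0"
    then obtain a b where "a \<ge> q" "pos (d + q) k = idx a b"
      by (auto simp: g_nth Q_def split: if_splits)
    then have "pos d k = idx (a - q) b" by (auto simp: idx_def pos_eq_iff)
    then show "pos d k \<in> indices" by simp
  qed
  moreover have "h \<in> supp_in indices"
    unfolding supp_in_iff
  proof (intro allI impI)
    fix d k assume *: "h $ d $$ k \<noteq> 0"
    then have "pos (d + q) (k + int q) \<in> frob_idx q"
      using f by (auto simp: h_nth supp_in_iff split: if_splits)
    moreover have "\<not> Q (d + q) (k + int q)" using * by (auto simp: h_nth split: if_splits)
    ultimately obtain a b where b: "b \<ge> q" "pos (d + q) (k + int q) = idx a b"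
      by (auto simp: Q_def frob_idx_def)
    then have "(k + int q - int q) mod int n = (int b - int q) mod int n"
      by (intro mod_diff_cong) (auto simp: idx_def pos_eq_iff)
    then have "pos d k = idx a (b - q)" using b by (auto simp: idx_def pos_eq_iff of_nat_diff)
    then show "pos d k \<in> indices" by simp
  qed
  moreover have "f = mon q 0 * g + mon 0 q * h"
  proof (rule fls_fps_eqI)
    fix d k
    show "f $ d $$ k = (mon q 0 * g + mon 0 q * h) $ d $$ k"
    proof (cases "q \<le> d")
      case False
      have "f $ d $$ k = 0"
      proof (rule ccontr)
        assume "f $ d $$ k \<noteq> 0"
        then have "pos d k \<in> frob_idx q" using f by (simp add: supp_in_iff)
        then show False using False by (auto simp: frob_idx_def idx_def pos_eq_iff)
      qed
      then show ?thesis using False by (simp add: mon_mult_nth)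
    next
      case True
      then show ?thesis
        by (cases "f $ d $$ k"; cases "Q d k") (simp_all add: mon_mult_nth g_nth h_nth)
    qed
  qed
  ultimately show thesis by (rule that)
qed

section \<open>Lengths as numbers of missing positions\<close>

lemma idx_less: "a + b < a' + b' \<Longrightarrow> idx a b < idx a' b'"
  by (metis div_le_mono idx_def not_le pos_div)

text \<open>The largest missing position can always be added: proper monomial multiples have larger
  degree, hence larger position, and are already present.\<close>

lemma mon_ideal_chain:
  assumes "mon_ideal X" "finite (indices - X)" "card (indices - X) = N"
  shows "\<exists>C. (\<forall>i\<le>N. mon_ideal (C i) \<and> X \<subseteq> C i) \<and> (\<forall>i<N. C i \<subset> C (Suc i))"
  using assms
proof (induction N arbitrary: X)
  case 0
  then show ?case by (intro exI[of _ "\<lambda>_. X"]) auto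
next
  case (Suc N)
  define l where "l = Max (indices - X)"
  have ne: "indices - X \<noteq> {}" using Suc.prems(3) by (metis card.empty nat.distinct(1))
  have l: "l \<in> indices" "l \<notin> X" using Max_in[OF Suc.prems(2) ne] by (auto simp: l_def)
  have max: "idx a b \<in> X" if "l < idx a b" for a b
    using Max_ge[OF Suc.prems(2), of "idx a b"] that by (auto simp: l_def)
  have "mon_ideal (insert l X)"
    unfolding mon_ideal_def
  proof (intro conjI allI impI)
    show "insert l X \<subseteq> indices" using l Suc.prems(1) by (auto simp: mon_ideal_def)
    fix a b a' b' assume ab: "idx a b \<in> insert l X"
    show "idx (a + a') (b + b') \<in> insert l X"
    proof (cases "idx a b \<in> X \<or> a' = 0 \<and> b' = 0")
      case True
      then show ?thesis using ab Suc.prems(1) by (auto simp: mon_ideal_def)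
    next
      case False
      then have "l < idx (a + a') (b + b')" using ab idx_less[of a b "a + a'" "b + b'"] by auto
      then show ?thesis using max by blast
    qed
  qed
  moreover have "indices - insert l X = (indices - X) - {l}" by auto
  moreover have "card ((indices - X) - {l}) = N" using Suc.prems l by (subst card_Diff_singleton) auto
  ultimately obtain C where C: "\<forall>i\<le>N. mon_ideal (C i) \<and> insert l X \<subseteq> C i" "\<forall>i<N. C i \<subset> C (Suc i)"
    using Suc.IH[of "insert l X"] Suc.prems(2) by auto
  define C' where "C' = case_nat X C"
  have "\<forall>i\<le>Suc N. mon_ideal (C' i) \<and> X \<subseteq> C' i"
    using C(1) Suc.prems(1) by (auto simp: C'_def split: nat.splits)
  moreover have "C' i \<subset> C' (Suc i)" if "i < Suc N" for i
  proof (cases i)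
    case 0
    then show ?thesis using C(1) l(2) by (auto simp: C'_def)
  next
    case (Suc j)
    then show ?thesis using C(2) that by (simp add: C'_def)
  qed
  ultimately show ?case by blast
qed

lemma supp_in_psubset:
  assumes "X \<subset> Y" "Y \<subseteq> indices"
  shows "supp_in X \<subset> supp_in Y"
proof -
  obtain l where l: "l \<in> Y" "l \<notin> X" using assms(1) by blast
  then have "l \<in> indices" using assms(2) by blast
  then obtain a b where "l = idx a b" by auto
  then have "mon a b \<in> supp_in Y" "mon a b \<notin> supp_in X" using l by (simp_all add: mon_in_iff)
  then show ?thesis using supp_in_mono[of X Y] assms(1) by blast
qed

text \<open>Each position has a unique pair (i, b) with b < n. It has the largest first entry among
  all pairs of that position; trading x^n for y^n as often as possible gives the largest second
  entry, b + n (i div n). The position is missing iff both entries are below q.\<close>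

lemma card_frob_idx_compl:
  "finite (indices - frob_idx q)"
  "card (indices - frob_idx q) = n ^ 2 * (q div n) + (q mod n) ^ 2"
proof -
  define k r where "k = q div n" and "r = q mod n"
  have q: "q = n * k + r" by (simp add: k_def r_def)
  have r: "r < n" using n_pos by (simp add: r_def)
  \<comment> \<open>For i < n k every b < n qualifies; for the remaining r values of i the condition
    becomes b < r.\<close>
  define S where "S = {..<n * k} \<times> {..<n} \<union> {n * k..<q} \<times> {..<r}"
  have S_iff: "(i, b) \<in> S \<longleftrightarrow> i < q \<and> b < n \<and> b + n * (i div n) < q" for i b
  proof (cases "i < n * k")
    case True
    then have "i div n < k" using n_pos by (simp add: div_less_iff_less_mult mult.commute)
    then have "n * (i div n) + n \<le> n * k"
      using mult_le_mono2[of "Suc (i div n)" k n] by simp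
    then show ?thesis using True r by (auto simp: S_def q)
  next
    case False
    have "i div n = k" if "i < q"
      using False that r n_pos by (intro div_nat_eqI) (auto simp: q mult.commute)
    then show ?thesis using False r by (auto simp: S_def q)
  qed
  have inj: "inj_on (case_prod idx) S"
    by (rule inj_onI) (auto simp: S_iff idx_eq_iff)
  have "case_prod idx ` S = indices - frob_idx q"
  proof (intro equalityI subsetI)
    fix l assume "l \<in> case_prod idx ` S"
    then obtain i b where l: "l = idx i b" and S: "i < q" "b < n" "b + n * (i div n) < q"
      by (auto simp: S_iff)
    have "l \<notin> frob_idx q"
    proof
      assume "l \<in> frob_idx q"
      then obtain c d where cd: "i + b = c + d" "b mod n = d mod n" "c \<ge> q \<or> d \<ge> q"
        by (auto simp: frob_idx_def l idx_eq_iff)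
      have d: "d = b + n * (d div n)" using cd(2) S(2) by (metis mod_less mult_div_mod_eq add.commute)
      then have i: "i = c + n * (d div n)" using cd(1) by linarith
      then have "d div n \<le> i div n" using n_pos by (simp add: less_eq_div_iff_mult_less_eq mult.commute)
      then have "d \<le> b + n * (i div n)" using d by (metis add_le_cancel_left mult_le_mono2)
      then show False using cd(3) S i by linarith
    qed
    then show "l \<in> indices - frob_idx q" by (simp add: l)
  next
    fix l assume "l \<in> indices - frob_idx q"
    then obtain a b where l: "l = idx a b" "idx a b \<notin> frob_idx q" by auto
    define i where "i = a + n * (b div n)"
    define c where "c = b mod n"
    have ic: "l = idx i c"
      by (simp add: l idx_eq_iff i_def c_def)
    have "i < q" using l(2) ic unfolding l(1) frob_idx_def by (metis (mono_tags, lifting) mem_Collect_eq not_le)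
    moreover have "c < n" using n_pos by (simp add: c_def)
    moreover have "c + n * (i div n) < q"
    proof -
      have "idx i c = idx (i mod n) (c + n * (i div n))" by (simp add: idx_eq_iff)
      then show ?thesis using l(2) ic unfolding l(1) frob_idx_def by (metis (mono_tags, lifting) mem_Collect_eq not_le)
    qed
    ultimately show "l \<in> case_prod idx ` S" using ic S_iff by (intro image_eqI[of _ _ "(i, c)"]) auto
  qed
  then have bij: "bij_betw (case_prod idx) S (indices - frob_idx q)" using inj by (simp add: bij_betw_def)
  have fin: "finite S" by (simp add: S_def)
  show "finite (indices - frob_idx q)" using bij fin bij_betw_finite by blast
  have "card S = n * k * n + r * r"
    unfolding S_def by (subst card_Un_disjoint) (auto simp: q)
  then show "card (indices - frob_idx q) = n ^ 2 * (q div n) + (q mod n) ^ 2"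
    using bij_betw_same_card[OF bij] by (simp add: k_def r_def power2_eq_square ac_simps)
qed

text \<open>Monomial ideals supply a chain of this length. Conversely, each strict step in any chain
  must add a leading position outside \<open>X\<close>, since equal leading positions would force
  equal ideals.\<close>

lemma length_supp_in:
  assumes X: "mon_ideal X" "X \<noteq> {}" and fin: "finite (indices - X)"
  shows "sup_chain_length (\<lambda>J. is_ideal J \<and> supp_in X \<subseteq> J) = enat (card (indices - X))"
proof -
  obtain C where C: "\<forall>i\<le>card (indices - X). mon_ideal (C i) \<and> X \<subseteq> C i"
      "\<forall>i<card (indices - X). C i \<subset> C (Suc i)"
    using mon_ideal_chain[OF X(1) fin refl] by blast
  show ?thesis
  proof (rule sup_chain_length_eqI[of _ _ "\<lambda>i. supp_in (C i)"])
    show "\<forall>i\<le>card (indices - X). is_ideal (supp_in (C i)) \<and> supp_in X \<subseteq> supp_in (C i)"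
      using C(1) is_ideal_supp_in supp_in_mono by blast
    show "\<forall>i<card (indices - X). supp_in (C i) \<subset> supp_in (C (Suc i))"
    proof (intro allI impI supp_in_psubset)
      fix i assume i: "i < card (indices - X)"
      show "C i \<subset> C (Suc i)" using C(2) i by blast
      show "C (Suc i) \<subseteq> indices" using C(1) Suc_leI[OF i] unfolding mon_ideal_def by blast
    qed
  next
    fix m D assume D: "\<forall>i\<le>m. is_ideal (D i) \<and> supp_in X \<subseteq> D i" "\<forall>i<m. D i \<subset> D (Suc i)"
    have Xi: "X \<subseteq> indices" using X(1) by (simp add: mon_ideal_def)
    \<comment> \<open>A monomial from \<open>X\<close> provides a nonzero element, hence one t^c
      K[[t]] inside all ideals of the chain.\<close>
    obtain l where l: "l \<in> X" using X(2) by blast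
    then have "l \<in> indices" using Xi by blast
    then obtain a b where "l = idx a b" by auto
    then have "mon a b \<in> supp_in X" using l by (simp add: mon_in_iff)
    moreover have "mon a b \<noteq> 0" by (simp add: mon_def)
    ultimately have van: "vanish (subdegree (mon a b) + n) \<subseteq> supp_in X"
      by (rule vanish_subset_ideal[OF is_ideal_supp_in[OF X(1)]])
    have Xl: "X \<subseteq> lead (D i)" if "i \<le> m" for i
      using subset_lead_supp_in[OF Xi] lead_mono[of "supp_in X" "D i"] D(1) that by blast
    have li: "lead (D i) - X \<subseteq> indices - X" if "i \<le> m" for i
      using lead_mono[of "D i" "supp_in indices"] lead_supp_in[of indices] is_idealD(1)[of "D i"] D(1) that
      by blast
    have "i \<le> m \<Longrightarrow> i \<le> card (lead (D i) - X)" for i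
    proof (induction i)
      case (Suc i)
      then have i: "i \<le> m" "i < m" by auto
      have "\<not> lead (D (Suc i)) \<subseteq> lead (D i)"
      proof
        assume *: "lead (D (Suc i)) \<subseteq> lead (D i)"
        have "D (Suc i) = D i"
        proof (rule ideal_eq_of_lead)
          show "vanish (subdegree (mon a b) + n) \<subseteq> D i" using van D(1) i by blast
          show "D i \<subseteq> D (Suc i)" using D(2) i by blast
        qed (use D(1) i Suc.prems * in auto)
        then show False using D(2) i by blast
      qed
      moreover have "lead (D i) \<subseteq> lead (D (Suc i))" using D(2) i by (intro lead_mono) auto
      ultimately have "lead (D i) - X \<subset> lead (D (Suc i)) - X"
        using Xl[OF i(1)] by blast
      moreover have "finite (lead (D (Suc i)) - X)" using li[OF Suc.prems] fin by (rule finite_subset)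
      ultimately have "card (lead (D i) - X) < card (lead (D (Suc i)) - X)" by (simp add: psubset_card_mono)
      then show ?case using Suc.IH[OF i(1)] by linarith
    qed auto
    then have "m \<le> card (lead (D m) - X)" by blast
    also have "\<dots> \<le> card (indices - X)" using li[OF le_refl] fin by (rule card_mono[rotated])
    finally show "m \<le> card (indices - X)" .
  qed
qed

text \<open>In characteristic 2 raising to the power q = 2^e is additive, so f = x g + y h gives f^q
  = x^q g^q + y^q h^q.\<close>

lemma frobenius_power_max:
  "frobenius_power copy (enc ` max_ideal) (2 ^ e) = enc ` supp_in (frob_idx (2 ^ e))"
proof (rule frobenius_power_copy)
  show "max_ideal \<subseteq> supp_in indices" by (rule is_idealD(1)[OF is_ideal_max])
  show I: "is_ideal (supp_in (frob_idx (2 ^ e)))" by (rule is_ideal_supp_in[OF mon_ideal_frob])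
  have gens: "mon (2 ^ e) 0 \<in> supp_in (frob_idx (2 ^ e))" "mon 0 (2 ^ e) \<in> supp_in (frob_idx (2 ^ e))"
    unfolding mon_in_iff frob_idx_def by blast+
  show "f ^ 2 ^ e \<in> supp_in (frob_idx (2 ^ e))" if f: "f \<in> max_ideal" for f
  proof -
    have pA: "g ^ i \<in> supp_in indices" if "g \<in> supp_in indices" for g i
      using that by (induction i) (auto simp: one_A mult_A)
    \<comment> \<open>A nonzero position has a positive exponent, so the splitting for q = 1 shows
      that x and y generate the maximal ideal.\<close>
    have "indices - {0} \<subseteq> frob_idx 1"
    proof
      fix l assume "l \<in> indices - {0}"
      then obtain a b where "l = idx a b" "l \<noteq> 0" by auto
      then show "l \<in> frob_idx 1" unfolding frob_idx_def using idx_eq_0_iff[of a b] by fastforce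
    qed
    then have "f \<in> supp_in (frob_idx 1)" using f supp_in_mono by (auto simp: max_ideal_def)
    then obtain g h where gh: "g \<in> supp_in indices" "h \<in> supp_in indices"
      "f = mon 1 0 * g + mon 0 1 * h" by (rule frob_idx_split)
    have "f ^ 2 ^ e = (mon 1 0 * g) ^ 2 ^ e + (mon 0 1 * h) ^ 2 ^ e"
      unfolding gh(3) by (rule freshmans_dream'[where n = e]) (simp_all add: CHAR_bit)
    also have "\<dots> = g ^ 2 ^ e * mon (2 ^ e) 0 + h ^ 2 ^ e * mon 0 (2 ^ e)"
      by (simp add: power_mult_distrib mon_power mult.commute)
    also have "\<dots> \<in> supp_in (frob_idx (2 ^ e))"
      using is_idealD(3,4)[OF I] gens pA gh(1,2) by blast
    finally show ?thesis .
  qed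
  fix J assume J: "is_ideal J" "\<And>f. f \<in> max_ideal \<Longrightarrow> f ^ 2 ^ e \<in> J"
  have "mon 1 0 \<in> max_ideal" "mon 0 1 \<in> max_ideal"
    by (simp_all add: max_ideal_def mon_in_iff idx_eq_0_iff)
  from J(2)[OF this(1)] J(2)[OF this(2)]
  have xy: "mon (2 ^ e) 0 \<in> J" "mon 0 (2 ^ e) \<in> J" by (simp_all add: mon_power)
  show "supp_in (frob_idx (2 ^ e)) \<subseteq> J"
  proof
    fix f assume "f \<in> supp_in (frob_idx (2 ^ e))"
    then obtain g h where gh: "g \<in> supp_in indices" "h \<in> supp_in indices"
      "f = mon (2 ^ e) 0 * g + mon 0 (2 ^ e) * h" by (rule frob_idx_split)
    show "f \<in> J"
      unfolding gh(3) using is_idealD(3,6)[OF J(1)] xy gh(1,2) by blast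
  qed
qed

lemma ring_char: "ring_char copy = 2"
  by (simp only: ring_char_copy CHAR_bit_fls_fps)

lemma hilbert_kunz:
  "hilbert_kunz copy (enc ` max_ideal) e = enat (n ^ 2 * (2 ^ e div n) + (2 ^ e mod n) ^ 2)"
proof -
  have I: "is_ideal (supp_in (frob_idx (2 ^ e)))" by (rule is_ideal_supp_in[OF mon_ideal_frob])
  have "frob_idx (2 ^ e) \<noteq> {}" unfolding frob_idx_def by blast
  from length_supp_in[OF mon_ideal_frob this card_frob_idx_compl(1)]
  show ?thesis
    unfolding hilbert_kunz_def ring_char frobenius_power_max module_length_copy[OF I]
    by (simp only: card_frob_idx_compl(2))
qed

text \<open>Substituting q = n a + r turns n^2 a + r^2 into n q - r (n - r), so the multiplicity is
  n.\<close>

lemma hilbert_kunz_eq: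
  "\<exists>l. hilbert_kunz copy (enc ` max_ideal) e = enat l \<and>
    int l = int n * int (ring_char copy) ^ e - int (2 ^ e mod n) * (int n - int (2 ^ e mod n))"
proof (intro exI conjI)
  have "int (2 ^ e) = int n * int (2 ^ e div n) + int (2 ^ e mod n)"
    by (metis mult_div_mod_eq of_nat_add of_nat_mult)
  then show "int (n ^ 2 * (2 ^ e div n) + (2 ^ e mod n) ^ 2) =
      int n * int (ring_char copy) ^ e - int (2 ^ e mod n) * (int n - int (2 ^ e mod n))"
    by (simp add: ring_char power2_eq_square algebra_simps)
qed (rule hilbert_kunz)

end

section \<open>Uniqueness of the decomposition, and the period\<close>

lemma periodic_multiple:
  fixes f :: "nat \<Rightarrow> 'a"
  assumes "\<forall>e\<ge>N. f (e + t) = f e" "e \<ge> N"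
  shows "f (e + t * i) = f e"
proof (induction i)
  case (Suc i)
  have "f (e + t * Suc i) = f ((e + t * i) + t)" by (simp add: algebra_simps)
  also have "\<dots> = f (e + t * i)" using assms by simp
  finally show ?case using Suc by simp
qed simp

text \<open>Two candidates differ by a constant times p^e. Both eventually repeat after the product
  of their periods, whereas p^e strictly increases, so the constant is 0.\<close>

lemma hk_phi_eqI:
  assumes dec: "hk_decomposition R m \<mu> \<phi>" and p: "ring_char R \<ge> 2"
  shows "hk_phi R m = \<phi>"
  unfolding hk_phi_def
proof (rule the_equality)
  show "\<exists>\<mu>. hk_decomposition R m \<mu> \<phi>" using dec by blast
  fix \<phi>' assume "\<exists>\<mu>. hk_decomposition R m \<mu> \<phi>'"
  then obtain \<mu>' where dec': "hk_decomposition R m \<mu>' \<phi>'" by blast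
  define p where "p = int (ring_char R)"
  have eq: "\<phi>' e - \<phi> e = (int \<mu>' - int \<mu>) * p ^ e" for e
  proof -
    obtain l where "hilbert_kunz R m e = enat l" "int l = int \<mu> * p ^ e - \<phi> e"
      using dec by (auto simp: hk_decomposition_def p_def)
    moreover obtain l' where "hilbert_kunz R m e = enat l'" "int l' = int \<mu>' * p ^ e - \<phi>' e"
      using dec' by (auto simp: hk_decomposition_def p_def)
    ultimately show ?thesis by (simp add: left_diff_distrib)
  qed
  obtain t N where t: "t > 0" "\<forall>e\<ge>N. \<phi> (e + t) = \<phi> e"
    using dec by (auto simp: hk_decomposition_def eventually_periodic_def)
  obtain t' N' where t': "t' > 0" "\<forall>e\<ge>N'. \<phi>' (e + t') = \<phi>' e"
    using dec' by (auto simp: hk_decomposition_def eventually_periodic_def)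
  define e where "e = max N N'"
  have "\<phi> (e + t * t') = \<phi> e" by (rule periodic_multiple[OF t(2)]) (simp add: e_def)
  moreover have "\<phi>' (e + t' * t) = \<phi>' e" by (rule periodic_multiple[OF t'(2)]) (simp add: e_def)
  ultimately have "(int \<mu>' - int \<mu>) * p ^ (e + t * t') = (int \<mu>' - int \<mu>) * p ^ e"
    using eq[of e] eq[of "e + t * t'"] by (auto simp: mult.commute[of t' t])
  moreover have "p ^ e < p ^ (e + t * t')"
    using p t(1) t'(1) by (intro power_strict_increasing) (auto simp: p_def)
  ultimately have "int \<mu>' - int \<mu> = 0" by auto
  then show "\<phi>' = \<phi>" using eq by (simp add: fun_eq_iff)
qed

theorem theorem6:
  fixes \<pi> :: nat
  assumes "\<pi> > 0"
  shows "\<exists>(R :: (nat \<Rightarrow> nat) ring) m.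
           noetherian_ring R \<and> local_ring R m \<and> krull_dim R = 1 \<and> prime (ring_char R) \<and>
           immediately_periodic (hk_phi R m) \<pi>"
proof -
  define n where "n = (2 :: nat) ^ \<pi> + 1"
  interpret graded_curve n by unfold_locales (simp add: n_def)
  define r where "r e = (2 :: nat) ^ e mod n" for e
  define \<phi> where "\<phi> e = int (r e) * (int n - int (r e))" for e
  have r_lt: "r e < n" for e by (simp add: r_def n_def)
  have per: "\<phi> (e + \<pi>) = \<phi> e" for e
  proof -
    \<comment> \<open>The cofactor is 2^e, since 2^pi + 1 = n.\<close>
    have "n dvd 2 ^ (e + \<pi>) + 2 ^ e"
      by (intro dvdI[of _ _ "2 ^ e"]) (simp add: n_def power_add algebra_simps)
    then have "n dvd r (e + \<pi>) + r e"
      by (simp add: r_def mod_add_eq dvd_eq_mod_eq_0)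
    then obtain c where c: "r (e + \<pi>) + r e = n * c" by (elim dvdE)
    \<comment> \<open>The two residues add up to less than 2 n, so to 0 or n. In the first case both
      vanish; in the second the product r (n - r) only swaps its factors.\<close>
    have "n * c < n * 2" using c r_lt[of e] r_lt[of "e + \<pi>"] by linarith
    then have "c = 0 \<or> c = 1" by auto
    then show ?thesis
    proof
      assume "c = 0"
      then show ?thesis using c by (simp add: \<phi>_def)
    next
      assume "c = 1"
      then have "int n = int (r (e + \<pi>)) + int (r e)" using c by simp
      then show ?thesis by (simp add: \<phi>_def mult.commute)
    qed
  qed
  have min: "\<pi> \<le> s" if s: "0 < s" "\<forall>e. \<phi> (e + s) = \<phi> e" for s
  proof (rule ccontr)
    assume "\<not> \<pi> \<le> s"
    then have "(2 :: nat) ^ s < 2 ^ \<pi>" by (intro power_strict_increasing) auto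
    moreover have "(2 :: nat) ^ 0 < 2 ^ s" using s(1) by (intro power_strict_increasing) auto
    ultimately have s': "1 < (2 :: nat) ^ s" "(2 :: nat) ^ s < 2 ^ \<pi>" by simp_all
    then have "(2 :: nat) ^ s < n" "1 < n" unfolding n_def by linarith+
    then have r: "r s = 2 ^ s" "r 0 = 1" by (simp_all add: r_def)
    have "int (2 ^ s) * (int n - int (2 ^ s)) = int n - 1"
      using s(2)[rule_format, of 0] by (simp add: \<phi>_def r)
    \<comment> \<open>The difference of the values at s and 0 factors, and neither factor vanishes
      for 0 < s < pi.\<close>
    then have "(int (2 ^ s) - 1) * (int (2 ^ \<pi>) - int (2 ^ s)) = 0"
      by (simp add: n_def algebra_simps)
    moreover have "int (2 ^ s) - 1 \<noteq> 0" "int (2 ^ \<pi>) - int (2 ^ s) \<noteq> 0" using s' by linarith+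
    ultimately show False by simp
  qed
  have "hk_decomposition copy (enc ` max_ideal) n \<phi>"
    unfolding hk_decomposition_def
  proof (intro conjI allI)
    show "eventually_periodic \<phi>" using per assms by (auto simp: eventually_periodic_def)
    show "\<exists>l. hilbert_kunz copy (enc ` max_ideal) e = enat l \<and>
        int l = int n * int (ring_char copy) ^ e - \<phi> e" for e
      unfolding \<phi>_def r_def by (rule hilbert_kunz_eq)
  qed (simp add: n_def)
  then have "hk_phi copy (enc ` max_ideal) = \<phi>" by (rule hk_phi_eqI) (simp add: ring_char)
  moreover have "immediately_periodic \<phi> \<pi>"
    using assms per min by (simp add: immediately_periodic_def)
  ultimately show ?thesis
    using noetherian local_ring krull_dim ring_char
    by (intro exI[of _ copy] exI[of _ "enc ` max_ideal"]) simp
qed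

end
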